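(* Let $(G,K)$ be one of the symmetric pairs (1)–(6) listed in the context, with associated ambient general linear group $G'$, subgroup $K'\subset G'$ isomorphic to a product $GL(a,\mathbb{C})\times GL(b,\mathbb{C})$, type $A$ flag variety $X'$, and smaller flag variety $X\cong G/B$ embedded in $X'$ as described there. Then each $K$-orbit on $X$ is exactly the intersection with $X$ of a $K'$-orbit on $X'$.
   Context: $J_m$ is the $m\times m$ antidiagonal matrix of $1$'s; $J_{n,n}=\begin{pmatrix}0&J_n\\-J_n&0\end{pmatrix}$; $I_{a,b}=\mathrm{diag}(1^a,(-1)^b)$; $I_{a,b,c}=\mathrm{diag}(1^a,(-1)^b,1^c)$. In each case $G\subset G'=GL(N,\mathbb{C})$ is the group preserving the indicated bilinear form on $\mathbb{C}^N$ (with determinant $1$), $h$ is the indicated matrix, $K=\{g\in G\mid hgh^{-1}=g\}$ and $K'=\{g\in G'\mid hgh^{-1}=g\}$. Throughout $p,q\ge0$ with $p+q=n$ (and $q\geq 1$ in (6)). (1) $N=2n+1$, $G=SO(2n+1,\mathbb{C})$ for the symmetric form $J_{2n+1}$, $h=I_{p,2q+1,p}$: $K\cong S(O(2p,\mathbb{C})\times O(2q+1,\mathbb{C}))$, $K'\cong GL(2p,\mathbb{C})\times GL(2q+1,\mathbb{C})$. (2) $N=2n$, $G=Sp(2n,\mathbb{C})$ for the skew form $J_{n,n}$, $h=I_{p,2q,p}$: $K\cong Sp(2p,\mathbb{C})\times Sp(2q,\mathbb{C})$, $K'\cong GL(2p,\mathbb{C})\times GL(2q,\mathbb{C})$. (3)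 $N=2n$, $G=Sp(2n,\mathbb{C})$ for $J_{n,n}$, $h=\sqrt{-1}\,I_{n,n}$: $K\cong GL(n,\mathbb{C})$, $K'\cong GL(n,\mathbb{C})\times GL(n,\mathbb{C})$. (4) $N=2n$, $G=SO(2n,\mathbb{C})$ for the symmetric form $J_{2n}$, $h=I_{p,2q,p}$: $K\cong S(O(2p,\mathbb{C})\times O(2q,\mathbb{C}))$, $K'\cong GL(2p,\mathbb{C})\times GL(2q,\mathbb{C})$. (5) $N=2n$, $G=SO(2n,\mathbb{C})$ for $J_{2n}$, $h=\sqrt{-1}\,I_{n,n}$: $K\cong GL(n,\mathbb{C})$, $K'\cong GL(n,\mathbb{C})\times GL(n,\mathbb{C})$. (6) $N=2n$, $G=SO(2n,\mathbb{C})$ for the standard symmetric form $\sum_i x_iy_i$, $h=I_{2p+1,2q-1}$: $K\cong S(O(2p+1,\mathbb{C})\times O(2q-1,\mathbb{C}))$, $K'\cong GL(2p+1,\mathbb{C})\times GL(2q-1,\mathbb{C})$. $X'$ is the variety of complete flags $F_\bullet=(F_0\subset F_1\subset\cdots\subset F_N=\mathbb{C}^N)$, $\dim F_i=i$. In cases (1)–(3), $X\subset X'$ is the set of flags with $F_{N-i}=F_i^\perp$ for all $i$ (isotropic flags), which is isomorphic to $G/B$ for $B$ a Borel subgroup of $G$. In the $SO(2n,\mathbb{C})$ cases the variety of such flags has two components, each a single $G$-orbit isomorphic to $G/B$, and $X$ is one of them: in (4) and (5), the component of flags with $\dim(F_n\cap\langle e_1,\dots,e_n\rangle)\equiv n\pmod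 2$; in (6), a fixed choice of one component. *)

theory Defs
  imports
    "Jordan_Normal_Form.VS_Connect"
    "HOL-Algebra.Group_Action"
begin

section \<open>Matrices\<close>

definition antidiag :: "nat \<Rightarrow> complex mat" where
  "antidiag m = mat m m (\<lambda>(i, j). if i + j + 1 = m then 1 else 0)"

definition skew_antidiag :: "nat \<Rightarrow> complex mat" where
  "skew_antidiag n = four_block_mat (0\<^sub>m n n) (antidiag n) (- antidiag n) (0\<^sub>m n n)"

definition I2 :: "nat \<Rightarrow> nat \<Rightarrow> complex mat" where
  "I2 a b = mat_diag (a + b) (\<lambda>i. if i < a then 1 else - 1)"

definition I3 :: "nat \<Rightarrow> nat \<Rightarrow> nat \<Rightarrow> complex mat" where
  "I3 a b c = mat_diag (a + b + c) (\<lambda>i. if i < a then 1 else if i < a + b then - 1 else 1)"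

section \<open>Groups\<close>

definition GL :: "nat \<Rightarrow> complex mat monoid" where
  "GL N = units_of (ring_mat TYPE(complex) N ())"

definition form :: "complex mat \<Rightarrow> complex vec \<Rightarrow> complex vec \<Rightarrow> complex" where
  "form S v w = v \<bullet> (S *\<^sub>v w)"

text \<open>For a skew form this is the symplectic group (where the determinant condition is automatic),
  for a symmetric form it is the special orthogonal group.\<close>

definition isometry_group :: "nat \<Rightarrow> complex mat \<Rightarrow> complex mat monoid" where
  "isometry_group N S = (GL N)\<lparr>carrier := {g \<in> carrier (GL N).
     (\<forall>v \<in> carrier_vec N. \<forall>w \<in> carrier_vec N. form S (g *\<^sub>v v) (g *\<^sub>v w) = form S v w) \<and>
     det g = 1}\<rparr>"

definition fixed_by_conj :: "nat \<Rightarrow> complex mat \<Rightarrow> complex mat monoid \<Rightarrow> complex mat monoid" where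
  "fixed_by_conj N h H = H\<lparr>carrier := {g \<in> carrier H. h * g * inv\<^bsub>GL N\<^esub> h = g}\<rparr>"

section \<open>Flags\<close>

abbreviation Vec :: "nat \<Rightarrow> (complex, complex vec) module" where
  "Vec N \<equiv> module_vec TYPE(complex) N"

definition subspace_dim :: "nat \<Rightarrow> complex vec set \<Rightarrow> nat" where
  "subspace_dim N W = vectorspace.dim class_ring ((Vec N)\<lparr>carrier := W\<rparr>)"

text \<open>A flag \<open>F\<^sub>0 \<subset> \<dots> \<subset> F\<^sub>N\<close> is the list of its members, so \<open>F\<^sub>i\<close> is \<open>F ! i\<close>.\<close>

type_synonym flag = "complex vec set list"

definition flag_variety :: "nat \<Rightarrow> flag set" where
  "flag_variety N = {F. length F = N + 1 \<and>
     (\<forall>i \<le> N. VectorSpace.subspace class_ring (F ! i) (Vec N) \<and> subspace_dim N (F ! i) = i) \<and>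
     (\<forall>i < N. F ! i \<subset> F ! (i + 1)) \<and>
     F ! N = carrier_vec N}"

definition flag_act :: "complex mat \<Rightarrow> flag \<Rightarrow> flag" where
  "flag_act g F = map (\<lambda>W. (\<lambda>v. g *\<^sub>v v) ` W) F"

definition perp :: "nat \<Rightarrow> complex mat \<Rightarrow> complex vec set \<Rightarrow> complex vec set" where
  "perp N S W = {v \<in> carrier_vec N. \<forall>w \<in> W. form S v w = 0}"

definition isotropic_flags :: "nat \<Rightarrow> complex mat \<Rightarrow> flag set" where
  "isotropic_flags N S = {F \<in> flag_variety N. \<forall>i \<le> N. F ! (N - i) = perp N S (F ! i)}"

definition coord_span :: "nat \<Rightarrow> nat \<Rightarrow> complex vec set" where
  "coord_span N k = LinearCombinations.module.span class_ring (Vec N) (unit_vec N ` {..<k})"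

definition even_component :: "nat \<Rightarrow> complex mat \<Rightarrow> flag set" where
  "even_component n S = {F \<in> isotropic_flags (2 * n) S.
     subspace_dim (2 * n) (F ! n \<inter> coord_span (2 * n) n) mod 2 = n mod 2}"

section \<open>The symmetric pairs\<close>

text \<open>\<open>symmetric_pair N S h X\<close>: the group \<open>G\<close> is \<open>isometry_group N S\<close>, the subgroups \<open>K\<close> and \<open>K'\<close>
  are cut out by \<open>h\<close>, and \<open>X\<close> is the flag variety of \<open>G\<close>.  In the last case \<open>X\<close> is either of the two
  components of the variety of isotropic flags; these components are exactly the two orbits
  of \<open>SO(2n)\<close> on it, and no coordinate subspace is singled out to name one of them.\<close>

inductive symmetric_pair :: "nat \<Rightarrow> complex mat \<Rightarrow> complex mat \<Rightarrow> flag set \<Rightarrow> bool" where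
  SO_odd:
    "p + q = n \<Longrightarrow> N = 2 * n + 1 \<Longrightarrow>
     symmetric_pair N (antidiag N) (I3 p (2 * q + 1) p) (isotropic_flags N (antidiag N))"
| Sp_Sp:
    "p + q = n \<Longrightarrow> N = 2 * n \<Longrightarrow>
     symmetric_pair N (skew_antidiag n) (I3 p (2 * q) p) (isotropic_flags N (skew_antidiag n))"
| Sp_GL:
    "N = 2 * n \<Longrightarrow>
     symmetric_pair N (skew_antidiag n) (\<i> \<cdot>\<^sub>m I2 n n) (isotropic_flags N (skew_antidiag n))"
| SO_even:
    "p + q = n \<Longrightarrow> N = 2 * n \<Longrightarrow>
     symmetric_pair N (antidiag N) (I3 p (2 * q) p) (even_component n (antidiag N))"
| SO_GL:
    "N = 2 * n \<Longrightarrow>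
     symmetric_pair N (antidiag N) (\<i> \<cdot>\<^sub>m I2 n n) (even_component n (antidiag N))"
| SO_even_odd:
    "p + q = n \<Longrightarrow> q \<ge> 1 \<Longrightarrow> N = 2 * n \<Longrightarrow>
     X \<in> orbits (isometry_group N (1\<^sub>m N)) (isotropic_flags N (1\<^sub>m N)) flag_act \<Longrightarrow>
     symmetric_pair N (1\<^sub>m N) (I2 (2 * p + 1) (2 * q - 1)) X"

end

theory Submission
  imports
    Defs
    "Jordan_Normal_Form.Schur_Decomposition"
    "Jordan_Normal_Form.DL_Rank"
begin

text \<open>A \<open>K\<close>-orbit on \<open>X\<close> lies in the \<open>K'\<close>-orbit of the same flag, because \<open>K\<close> is contained in
  \<open>K'\<close> and preserves \<open>X\<close>. The content is the converse: if \<open>F\<close> and \<open>k F\<close> both lie in \<open>X\<close> for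
  some \<open>k\<close> in \<open>K'\<close>, then \<open>k F = g F\<close> for some \<open>g\<close> in \<open>K\<close>.

  Let \<open>B\<close> be the form of \<open>S\<close>, let \<open>k\<^sup>*\<close> be the adjoint of \<open>k\<close>, and put \<open>A = k\<^sup>* k\<close>. Since
  \<open>h\<close> is itself an isometry of \<open>B\<close>, the matrix \<open>A\<close> commutes with \<open>h\<close>. Since
  \<open>B(w, A v) = B(k w, k v)\<close> and both \<open>F\<close> and \<open>k F\<close> are isotropic, \<open>A\<close> stabilises \<open>F\<close>. An
  invertible complex matrix has an inverse square root that is a polynomial in it
  (\<open>matrix_inverse_square_root\<close>); the one of \<open>A\<close>, say \<open>C\<close>, is therefore self-adjoint,
  commutes with \<open>h\<close> and stabilises \<open>F\<close>. So \<open>g = k C\<close> is an isometry that commutes with \<open>h\<close>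
  and satisfies \<open>g F = k F\<close> (\<open>isometry_between_isotropic_flags\<close>).

  It remains to arrange \<open>det g = 1\<close>, where a priori \<open>det g\<close> is \<open>1\<close> or \<open>- 1\<close>. In odd
  dimension the sign of \<open>g\<close> can be changed. In even dimension suppose that \<open>S\<^sup>T = \<epsilon> S\<close> with
  \<open>\<epsilon>\<close> equal to \<open>1\<close> or \<open>- 1\<close>. For Lagrangian subspaces \<open>L\<close> and \<open>E\<close>, the formula
  \<open>det g = (- \<epsilon>) ^ (dim (L \<inter> E) + dim (g L \<inter> E))\<close> holds (\<open>det_isometry_via_lagrangian\<close>).
  This rests on two facts: any Lagrangian subspace is carried to any other by a product of
  reflections, or transvections if \<open>\<epsilon> = - 1\<close>, whose number is determined by the dimension of
  the intersection; and an isometry that stabilises a Lagrangian subspace has determinant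
  \<open>1\<close>. For a skew form the formula gives \<open>det g = 1\<close>. For a symmetric form it says that the
  isometries of determinant \<open>1\<close> are those that preserve the parity which separates the two
  families of isotropic flags, so \<open>g\<close> has determinant \<open>1\<close> as soon as \<open>F\<close> and \<open>g F\<close> lie in
  the same one.\<close>

section \<open>Inverse square roots that are polynomials in the matrix\<close>

text \<open>The roots are added one at a time. If \<open>m\<close> divides \<open>x r\<^sup>2 - 1\<close>, say \<open>x r\<^sup>2 - 1 = m t\<close>, then
  replacing \<open>r\<close> by \<open>r + c m\<close> for a constant \<open>c\<close> turns the cofactor \<open>t\<close> into
  \<open>t + 2 c x r + c\<^sup>2 x m\<close>, and this vanishes at the next root \<open>e\<close> for a suitable \<open>c\<close>: the
  condition on \<open>c\<close> is quadratic if \<open>m(e) \<noteq> 0\<close>, and otherwise it is linear with leading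
  coefficient \<open>2 e r(e)\<close>, where \<open>e r(e)\<^sup>2 = 1\<close>. So repeated roots cause no trouble.\<close>

lemma inverse_square_root_modulo:
  fixes es :: "complex list"
  assumes "0 \<notin> set es"
  shows "\<exists>r. (\<Prod>e\<leftarrow>es. [:- e, 1:]) dvd [:0, 1:] * r * r - 1"
  using assms
proof (induction es)
  case (Cons e es)
  define m where "m = (\<Prod>e\<leftarrow>es. [:- e, 1:])"
  obtain r t where rt: "[:0, 1:] * r * r - 1 = m * t"
    using Cons by (auto simp: m_def dvd_def)
  \<comment> \<open>The value at \<open>e\<close> of the new cofactor, as a polynomial in \<open>c\<close>.\<close>
  define f where "f = [:poly t e, 2 * e * poly r e, e * poly m e:]"
  have "\<exists>c. poly f c = 0"
  proof (cases "poly m e = 0")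
    case True
    have "poly ([:0, 1:] * r * r - 1) e = 0"
      unfolding rt using True by simp
    then have "poly r e \<noteq> 0"
      by auto
    then have "poly f (- poly t e / (2 * e * poly r e)) = 0"
      using Cons.prems True by (simp add: f_def)
    then show ?thesis ..
  next
    case False
    then have "degree f \<noteq> 0"
      using Cons.prems by (simp add: f_def)
    then show ?thesis
      using fundamental_theorem_of_algebra[of f] constant_degree[of f] by auto
  qed
  then obtain c where c: "poly f c = 0"
    by blast
  define X where "X = [:0, 1 :: complex:]"
  define s where "s = t + ([:c:] * (X * r) + [:c:] * (X * r) + [:c:] * [:c:] * (X * m))"
  have "poly s e = 0"
    using c by (simp add: s_def f_def X_def algebra_simps)
  then have "[:- e, 1:] dvd s"
    by (simp add: poly_eq_0_iff_dvd)
  moreover have "X * (r + [:c:] * m) * (r + [:c:] * m) - 1 = m * s"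
  proof -
    have "X * (r + C * m) * (r + C * m) - 1 = (X * r * r - 1) + m * (C * (X * r) + C * (X * r) + C * C * (X * m))" for C
      by (simp add: algebra_simps)
    then show ?thesis
      using rt unfolding s_def X_def by (simp only: distrib_left)
  qed
  ultimately have "m * [:- e, 1:] dvd X * (r + [:c:] * m) * (r + [:c:] * m) - 1"
    by (simp only: mult_dvd_mono[OF dvd_refl])
  moreover have "(\<Prod>e\<leftarrow>e # es. [:- e, 1:]) = m * [:- e, 1:]"
    by (simp add: m_def)
  ultimately show ?case
    unfolding X_def by metis
qed simp

definition poly_mat :: "complex mat \<Rightarrow> complex poly \<Rightarrow> complex mat" where
  "poly_mat A p = fold_coeffs (\<lambda>c M. c \<cdot>\<^sub>m 1\<^sub>m (dim_row A) + A * M) p (0\<^sub>m (dim_row A) (dim_row A))"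

lemma poly_mat_0:
  assumes "A \<in> carrier_mat n n"
  shows "poly_mat A 0 = 0\<^sub>m n n"
  using assms by (simp add: poly_mat_def)

lemma poly_mat_pCons:
  assumes A: "A \<in> carrier_mat n n"
  shows "poly_mat A (pCons c p) = c \<cdot>\<^sub>m 1\<^sub>m n + A * poly_mat A p"
proof (cases "c = 0 \<and> p = 0")
  case True
  then show ?thesis using A by (intro eq_matI) (auto simp: poly_mat_0[OF A])
next
  case False
  then show ?thesis using A by (auto simp: poly_mat_def)
qed

lemma poly_mat_carrier:
  assumes A: "A \<in> carrier_mat n n"
  shows "poly_mat A p \<in> carrier_mat n n"
  by (induction p) (use A in \<open>auto simp: poly_mat_0[OF A] poly_mat_pCons[OF A]\<close>)

lemma poly_mat_add:
  assumes A: "A \<in> carrier_mat n n"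
  shows "poly_mat A (p + q) = poly_mat A p + poly_mat A q"
proof (induction p q rule: poly_induct2)
  case 0
  then show ?case using A by (simp add: poly_mat_0[OF A])
next
  case (pCons a p b q)
  note [simp] = poly_mat_carrier[OF A]
  have "A * (poly_mat A p + poly_mat A q) = A * poly_mat A p + A * poly_mat A q"
    using A by (intro mult_add_distrib_mat[of _ n n _ n]) auto
  then show ?case
    using A pCons
    by (intro eq_matI) (auto simp: poly_mat_pCons[OF A] carrier_matD[OF poly_mat_carrier[OF A]] algebra_simps)
qed

lemma poly_mat_smult:
  assumes A: "A \<in> carrier_mat n n"
  shows "poly_mat A (smult c p) = c \<cdot>\<^sub>m poly_mat A p"
proof (induction p)
  case 0
  then show ?case using A by (simp add: poly_mat_0[OF A])
next
  case (pCons a p)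
  note [simp] = poly_mat_carrier[OF A]
  have "A * (c \<cdot>\<^sub>m poly_mat A p) = c \<cdot>\<^sub>m (A * poly_mat A p)"
    using A by (intro mult_smult_distrib[of _ n n _ n]) auto
  then show ?case
    using A pCons
    by (intro eq_matI) (auto simp: poly_mat_pCons[OF A] carrier_matD[OF poly_mat_carrier[OF A]] algebra_simps)
qed

lemma poly_mat_mult:
  assumes A: "A \<in> carrier_mat n n"
  shows "poly_mat A (p * q) = poly_mat A p * poly_mat A q"
proof (induction p)
  case 0
  show ?case using A poly_mat_carrier[OF A, of q] by (simp add: poly_mat_0[OF A])
next
  case (pCons a p)
  note car [simp] = poly_mat_carrier[OF A]
  have "poly_mat A (pCons a p * q) = a \<cdot>\<^sub>m poly_mat A q + poly_mat A (pCons 0 (p * q))"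
    by (simp add: poly_mat_add[OF A] poly_mat_smult[OF A])
  also have "poly_mat A (pCons 0 (p * q)) = A * (poly_mat A p * poly_mat A q)"
  proof -
    have "A * (poly_mat A p * poly_mat A q) \<in> carrier_mat n n"
      using A car by (meson mult_carrier_mat)
    then show ?thesis
      using A pCons by (intro eq_matI) (auto simp: poly_mat_pCons[OF A])
  qed
  also have "A * (poly_mat A p * poly_mat A q) = (A * poly_mat A p) * poly_mat A q"
    using A by (intro assoc_mult_mat[of _ n n _ n _ n, symmetric]) auto
  also have "a \<cdot>\<^sub>m poly_mat A q = (a \<cdot>\<^sub>m 1\<^sub>m n) * poly_mat A q"
    using mult_smult_assoc_mat[of "1\<^sub>m n" n n "poly_mat A q" n a] left_mult_one_mat[OF car] by simp
  also have "\<dots> + (A * poly_mat A p) * poly_mat A q = (a \<cdot>\<^sub>m 1\<^sub>m n + A * poly_mat A p) * poly_mat A q"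
    using A by (intro add_mult_distrib_mat[of _ n n _ _ n, symmetric]) (auto intro: mult_carrier_mat)
  finally show ?case
    by (simp add: poly_mat_pCons[OF A])
qed

lemma poly_mat_induct [consumes 1, case_names zero step]:
  assumes A: "A \<in> carrier_mat n n"
    and "P (0\<^sub>m n n)"
    and "\<And>c M. M \<in> carrier_mat n n \<Longrightarrow> P M \<Longrightarrow> P (c \<cdot>\<^sub>m 1\<^sub>m n + A * M)"
  shows "P (poly_mat A p)"
  by (induction p) (use assms poly_mat_carrier[OF A] in \<open>auto simp: poly_mat_0[OF A] poly_mat_pCons[OF A]\<close>)

lemma poly_mat_similar:
  assumes "similar_mat_wit A B P Q" "A \<in> carrier_mat n n"
  shows "poly_mat A p = P * poly_mat B p * Q"
proof -
  have car: "A \<in> carrier_mat n n" "B \<in> carrier_mat n n" "P \<in> carrier_mat n n" "Q \<in> carrier_mat n n"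
    and eq: "P * Q = 1\<^sub>m n" "Q * P = 1\<^sub>m n" "A = P * B * Q"
    using similar_mat_witD2[OF assms(2,1)] by auto
  show ?thesis
  proof (induction p)
    case 0
    then show ?case using car by (simp add: poly_mat_0)
  next
    case (pCons a p)
    define M where "M = poly_mat B p"
    have M: "M \<in> carrier_mat n n"
      using poly_mat_carrier car M_def by blast
    have "poly_mat A (pCons a p) = a \<cdot>\<^sub>m 1\<^sub>m n + A * (P * M * Q)"
      unfolding poly_mat_pCons[OF car(1)] M_def pCons.IH ..
    also have "A * (P * M * Q) = P * B * (Q * P) * M * Q"
      using car M by (simp add: eq(3) assoc_mult_mat[of _ n n _ n _ n])
    also have "\<dots> = P * (B * M) * Q"
      using car M eq by (simp add: assoc_mult_mat[of _ n n _ n _ n])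
    also have "a \<cdot>\<^sub>m 1\<^sub>m n = P * (a \<cdot>\<^sub>m 1\<^sub>m n) * Q"
      using car eq mult_smult_distrib[of P n n "1\<^sub>m n" n a] mult_smult_assoc_mat[of P n n Q n a] by simp
    also have "P * (a \<cdot>\<^sub>m 1\<^sub>m n) * Q + P * (B * M) * Q = P * (a \<cdot>\<^sub>m 1\<^sub>m n + B * M) * Q"
      using car M by (simp add: mult_add_distrib_mat[of P n n _ n] add_mult_distrib_mat[of _ n n _ Q n])
    finally show ?case by (simp add: poly_mat_pCons[OF car(2)] M_def)
  qed
qed

lemma mult_unit_vec_index:
  fixes M :: "'a :: semiring_1 mat"
  assumes "M \<in> carrier_mat n m" "i < n" "j < m"
  shows "(M *\<^sub>v unit_vec m j) $ i = M $$ (i, j)"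
  using assms by (simp add: scalar_prod_right_unit)

text \<open>The Cayley-Hamilton theorem for a triangular matrix: the factor of the \<open>k\<close>-th diagonal
  entry maps the span of the first \<open>k + 1\<close> unit vectors into the span of the first \<open>k\<close> of
  them.\<close>

lemma upper_triangular_annihilated:
  fixes B :: "complex mat"
  assumes B: "B \<in> carrier_mat n n" "upper_triangular B"
  shows "poly_mat B (\<Prod>e\<leftarrow>diag_mat B. [:- e, 1:]) = 0\<^sub>m n n"
proof -
  have *: "poly_mat B (\<Prod>e\<leftarrow>take k (diag_mat B). [:- e, 1:]) *\<^sub>v v = 0\<^sub>v n"
    if "k \<le> n" "v \<in> carrier_vec n" "\<And>i. k \<le> i \<Longrightarrow> i < n \<Longrightarrow> v $ i = 0" for k v
    using that
  proof (induction k arbitrary: v)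
    case 0
    then have "v = 0\<^sub>v n" by auto
    then show ?case using poly_mat_carrier[OF B(1), of 1] by (auto intro!: eq_vecI)
  next
    case (Suc k)
    define p where "p = (\<Prod>e\<leftarrow>take k (diag_mat B). [:- e, 1:])"
    define w where "w = poly_mat B [:- (B $$ (k,k)), 1:] *\<^sub>v v"
    have w: "w = B *\<^sub>v v - B $$ (k,k) \<cdot>\<^sub>v v"
    proof -
      have "poly_mat B [:- (B $$ (k,k)), 1:] = - (B $$ (k,k)) \<cdot>\<^sub>m 1\<^sub>m n + B"
        using B by (intro eq_matI) (auto simp: poly_mat_pCons[OF B(1)] poly_mat_0[OF B(1)])
      then show ?thesis
        using B Suc.prems unfolding w_def
        by (intro eq_vecI) (auto simp: add_mult_distrib_mat_vec[of _ n n])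
    qed
    have tk: "take (Suc k) (diag_mat B) = take k (diag_mat B) @ [B $$ (k,k)]"
      using B Suc.prems by (simp add: diag_mat_def take_Suc_conv_app_nth)
    have wc: "w \<in> carrier_vec n" using B Suc.prems by (auto simp: w)
    have "w $ i = 0" if i: "k \<le> i" "i < n" for i
    proof -
      have "(B *\<^sub>v v) $ i = (\<Sum>j = 0..<n. B $$ (i,j) * v $ j)"
        using B i Suc.prems by (auto simp: scalar_prod_def)
      also have "\<dots> = (\<Sum>j = 0..<n. if j = k then B $$ (i,k) * v $ k else 0)"
      proof (rule sum.cong)
        fix j assume j: "j \<in> {0..<n}"
        show "B $$ (i,j) * v $ j = (if j = k then B $$ (i,k) * v $ k else 0)"
        proof (cases "j < k")
          case True
          then have "B $$ (i,j) = 0" using B i by auto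
          then show ?thesis using True by simp
        qed (use Suc.prems j in auto)
      qed simp
      also have "\<dots> = B $$ (i,k) * v $ k"
        using Suc.prems by simp
      finally have "(B *\<^sub>v v) $ i = B $$ (i,k) * v $ k" .
      moreover have "i \<noteq> k \<Longrightarrow> B $$ (i,k) = 0 \<and> v $ i = 0"
        using B i Suc.prems by auto
      ultimately show ?thesis
        using B i Suc.prems by (cases "i = k") (auto simp: w)
    qed
    then have "poly_mat B p *\<^sub>v w = 0\<^sub>v n"
      unfolding p_def using Suc.prems wc by (intro Suc.IH) auto
    moreover have "poly_mat B (p * [:- (B $$ (k,k)), 1:]) *\<^sub>v v = poly_mat B p *\<^sub>v w"
      unfolding w_def poly_mat_mult[OF B(1)]
      using Suc.prems poly_mat_carrier[OF B(1)] by (intro assoc_mult_mat_vec[of _ n n _ n]) auto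
    ultimately show ?case
      by (simp only: tk map_append prod_list.append p_def list.simps prod_list.Cons prod_list.Nil mult_1_right)
  qed
  define M where "M = poly_mat B (\<Prod>e\<leftarrow>diag_mat B. [:- e, 1:])"
  have M: "M \<in> carrier_mat n n"
    unfolding M_def by (rule poly_mat_carrier[OF B(1)])
  have "M *\<^sub>v v = 0\<^sub>v n" if "v \<in> carrier_vec n" for v
    using *[of n v] that B by (simp add: M_def diag_mat_def)
  then have "M $$ (i, j) = 0" if "i < n" "j < n" for i j
    using mult_unit_vec_index[OF M that] that by simp
  then show ?thesis
    using M unfolding M_def[symmetric] by (intro eq_matI) auto
qed

text \<open>The Schur form supplies a polynomial with nonzero roots that annihilates the matrix, so an
  inverse square root modulo this polynomial evaluates to one of the matrix. That the root
  is a polynomial in the matrix is the point: it inherits commutation relations, invariant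
  subspaces and self-adjointness.\<close>

lemma matrix_inverse_square_root:
  assumes A: "A \<in> carrier_mat n n" and det: "det A \<noteq> 0"
  shows "\<exists>r. A * poly_mat A r * poly_mat A r = 1\<^sub>m n"
proof -
  obtain es where "char_poly A = (\<Prod>e\<leftarrow>es. [:- e, 1:])"
    using char_poly_factorized[OF A] by blast
  then obtain B where B: "upper_triangular B" "similar_mat A B"
    using schur_decomposition_exists[OF A] by metis
  then obtain P Q where wit: "similar_mat_wit A B P Q"
    by (auto simp: similar_mat_def)
  note D = similar_mat_witD2[OF A wit]
  have "det A = det B"
    using B(2) det_similar by blast
  then have "0 \<notin> set (diag_mat B)"
    using det det_upper_triangular[OF B(1) D(5)] by (simp add: prod_list_zero_iff)
  from inverse_square_root_modulo[OF this] obtain r t where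
    rt: "[:0, 1:] * r * r - 1 = (\<Prod>e\<leftarrow>diag_mat B. [:- e, 1:]) * t"
    by (auto simp: dvd_def)
  have "poly_mat A ((\<Prod>e\<leftarrow>diag_mat B. [:- e, 1:]) * t) = 0\<^sub>m n n"
    using D(6,7) poly_mat_carrier[OF A, of t] unfolding poly_mat_mult[OF A]
    by (subst poly_mat_similar[OF wit A])
      (simp add: upper_triangular_annihilated[OF D(5) B(1)])
  moreover have "[:0, 1:] * r * r = 1 + (\<Prod>e\<leftarrow>diag_mat B. [:- e, 1:]) * t"
    by (simp flip: rt)
  moreover have "poly_mat A 1 = 1\<^sub>m n" "poly_mat A [:0, 1:] = A"
    using A by (auto simp: one_pCons poly_mat_pCons[OF A] poly_mat_0[OF A] intro!: eq_matI)
  ultimately have "poly_mat A ([:0, 1:] * r * r) = 1\<^sub>m n"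
    by (simp add: poly_mat_add[OF A])
  then show ?thesis
    unfolding poly_mat_mult[OF A] \<open>poly_mat A [:0, 1:] = A\<close> by blast
qed

section \<open>Subspaces, bases and a determinant identity\<close>

lemma det_nonzero_inverse:
  fixes A :: "'a :: field mat"
  assumes "A \<in> carrier_mat n n" "det A \<noteq> 0"
  obtains B where "B \<in> carrier_mat n n" "A * B = 1\<^sub>m n" "B * A = 1\<^sub>m n"
  using det_non_zero_imp_unit[OF assms, of "()"] by (auto simp: Units_def ring_mat_simps)

lemma mult_inverse_mat_vec:
  fixes A B :: "'a :: comm_ring_1 mat"
  assumes "A \<in> carrier_mat n n" "B \<in> carrier_mat n n" "A * B = 1\<^sub>m n" "v \<in> carrier_vec n"
  shows "A *\<^sub>v (B *\<^sub>v v) = v"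
  using assms by (simp flip: assoc_mult_mat_vec[of _ n n _ n])

context vec_space
begin

lemma subspace_iff:
  "VectorSpace.subspace class_ring W V \<longleftrightarrow> W \<subseteq> carrier_vec n \<and> 0\<^sub>v n \<in> W \<and>
     (\<forall>v\<in>W. \<forall>w\<in>W. v + w \<in> W) \<and> (\<forall>c. \<forall>v\<in>W. c \<cdot>\<^sub>v v \<in> W)"
  using vec_vs[where 'a = 'a, of n] vec_module[where 'a = 'a, of n]
  by (auto simp: VectorSpace.subspace_def submodule_def module_vec_simps class_ring_simps)

lemma subspace_add:
  "VectorSpace.subspace class_ring W V \<Longrightarrow> v \<in> W \<Longrightarrow> w \<in> W \<Longrightarrow> v + w \<in> W"
  unfolding subspace_iff by blast

lemma subspace_smult:
  "VectorSpace.subspace class_ring W V \<Longrightarrow> v \<in> W \<Longrightarrow> c \<cdot>\<^sub>v v \<in> W"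
  unfolding subspace_iff by blast

lemma basis_of_subspace_iff:
  assumes W: "VectorSpace.subspace class_ring W V"
  shows "vectorspace.basis class_ring (vs W) B \<longleftrightarrow> B \<subseteq> W \<and> lin_indpt B \<and> span B = W"
proof -
  interpret W: vectorspace class_ring "vs W"
    using subspace_is_vs[OF W] .
  have sub: "submodule class_ring W V"
    using W by (simp add: VectorSpace.subspace_def)
  show ?thesis
    using span_li_not_depend[OF _ sub, of B] by (auto simp: W.basis_def)
qed

lemma subspace_basis_exists:
  assumes W: "VectorSpace.subspace class_ring W V" and C: "C \<subseteq> W" "lin_indpt C"
  obtains B where "finite B" "C \<subseteq> B" "B \<subseteq> W" "lin_indpt B" "span B = W"
    "card B = vectorspace.dim class_ring (vs W)" "card B \<le> n"
proof -
  interpret W: vectorspace class_ring "vs W"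
    using subspace_is_vs[OF W] .
  have Wc: "W \<subseteq> carrier_vec n"
    using W by (simp add: subspace_iff)
  have sub: "submodule class_ring W V"
    using W by (simp add: VectorSpace.subspace_def)
  have eq: "W.lin_dep B = lin_dep B" if "B \<subseteq> W" for B
    using span_li_not_depend[OF that sub] by simp
  let ?P = "\<lambda>T. C \<subseteq> T \<and> T \<subseteq> W \<and> lin_indpt T"
  have "\<exists>B. finite B \<and> maximal B ?P"
  proof (rule maximal_exists[of ?P n C])
    show "finite A \<and> card A \<le> n" if "?P A" for A
      using that Wc li_le_dim[of A] dim_is_n by auto
  qed (use C in auto)
  then obtain B where B: "finite B" "maximal B ?P"
    by blast
  then have CB: "C \<subseteq> B"
    by (auto simp: maximal_def)
  have "maximal B (\<lambda>T. T \<subseteq> carrier (vs W) \<and> W.lin_indpt T)"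
    unfolding maximal_def
  proof (intro conjI allI impI)
    have "?P B"
      using B(2) unfolding maximal_def by (rule conjunct1)
    then show "B \<subseteq> carrier (vs W)" "W.lin_indpt B"
      by (simp_all add: eq)
  next
    fix A assume A: "B \<subseteq> A \<and> A \<subseteq> carrier (vs W) \<and> W.lin_indpt A"
    then have "A \<subseteq> W"
      by simp
    then have "?P A"
      using A CB eq by blast
    then show "A = B"
      using A B(2) unfolding maximal_def by blast
  qed
  then have basis: "W.basis B"
    by (rule W.max_li_is_basis)
  show thesis
  proof (rule that[OF B(1) CB])
    show "B \<subseteq> W" "lin_indpt B" "span B = W"
      using basis basis_of_subspace_iff[OF W] by auto
    then show "card B \<le> n"
      using Wc li_le_dim[of B] dim_is_n by auto
    show "card B = W.dim"
      using W.dim_basis[OF B(1) basis] by simp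
  qed
qed

lemma subspace_dim_eq_card:
  assumes "VectorSpace.subspace class_ring W V" "finite B" "B \<subseteq> W" "lin_indpt B" "span B = W"
  shows "vectorspace.dim class_ring (vs W) = card B"
proof -
  interpret W: vectorspace class_ring "vs W"
    using subspace_is_vs[OF assms(1)] .
  show ?thesis
    using W.dim_basis[OF assms(2)] basis_of_subspace_iff[OF assms(1)] assms by blast
qed

lemma lin_indpt_empty: "lin_indpt {}"
  by (simp add: lin_dep_def)

lemma subspace_basis:
  assumes "VectorSpace.subspace class_ring W V"
  obtains B where "finite B" "B \<subseteq> W" "lin_indpt B" "span B = W"
    "card B = vectorspace.dim class_ring (vs W)"
  using subspace_basis_exists[OF assms empty_subsetI lin_indpt_empty] by metis

lemma subspace_dim_le:
  assumes "VectorSpace.subspace class_ring W V"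
  shows "vectorspace.dim class_ring (vs W) \<le> n"
  using subspace_basis_exists[OF assms empty_subsetI lin_indpt_empty] by metis

lemma subspace_image:
  assumes W: "VectorSpace.subspace class_ring W V" and g: "g \<in> carrier_mat n n"
  shows "VectorSpace.subspace class_ring ((*\<^sub>v) g ` W) V"
proof -
  have Wc: "v \<in> W \<Longrightarrow> v \<in> carrier_vec n" for v
    using W by (auto simp: subspace_iff)
  have "0\<^sub>v n = g *\<^sub>v 0\<^sub>v n"
    using g by auto
  moreover have "g *\<^sub>v v + g *\<^sub>v w = g *\<^sub>v (v + w)" if "v \<in> W" "w \<in> W" for v w
    using that g Wc by (simp add: mult_add_distrib_mat_vec[of _ n n])
  moreover have "c \<cdot>\<^sub>v (g *\<^sub>v v) = g *\<^sub>v (c \<cdot>\<^sub>v v)" if "v \<in> W" for c v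
    using that g Wc by (simp add: mult_mat_vec[of _ n n])
  ultimately show ?thesis
    using W g unfolding subspace_iff by (auto intro!: imageI)
qed

lemma dim_image:
  assumes W: "VectorSpace.subspace class_ring W V" and g: "g \<in> carrier_mat n n" "det g \<noteq> 0"
  shows "vectorspace.dim class_ring (vs ((*\<^sub>v) g ` W)) = vectorspace.dim class_ring (vs W)"
proof -
  have Wc: "v \<in> W \<Longrightarrow> v \<in> carrier_vec n" for v
    using W by (auto simp: subspace_iff)
  obtain g' where g': "g' \<in> carrier_mat n n" "g' * g = 1\<^sub>m n"
    using det_nonzero_inverse[OF g] by blast
  interpret W: vectorspace class_ring "vs W"
    using subspace_is_vs[OF W] .
  interpret gW: vectorspace class_ring "vs ((*\<^sub>v) g ` W)"
    using subspace_is_vs[OF subspace_image[OF W g(1)]] .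
  have "linear_map class_ring (vs W) (vs ((*\<^sub>v) g ` W)) ((*\<^sub>v) g)"
  proof unfold_locales
    show "(*\<^sub>v) g \<in> LinearCombinations.module_hom class_ring (vs W) (vs ((*\<^sub>v) g ` W))"
      using g Wc by (auto simp: LinearCombinations.module_hom_def mult_add_distrib_mat_vec[of _ n n] mult_mat_vec[of _ n n])
  qed
  then interpret g: linear_map class_ring "vs W" "vs ((*\<^sub>v) g ` W)" "(*\<^sub>v) g" .
  obtain B where B: "finite B" "B \<subseteq> W" "lin_indpt B" "span B = W"
    by (rule subspace_basis[OF W])
  then have "W.basis B"
    using basis_of_subspace_iff[OF W] by simp
  then have "W.fin_dim"
    using B(1) unfolding W.fin_dim_def W.basis_def by blast
  moreover have "inj_on ((*\<^sub>v) g) (carrier (vs W))"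
    by (rule inj_on_inverseI[of _ "(*\<^sub>v) g'"])
      (use mult_inverse_mat_vec[OF g'(1) g(1) g'(2)] Wc in auto)
  ultimately show ?thesis
    using g.dim_eq by simp
qed

text \<open>Needed to follow how the intersection of two subspaces grows when one of them is
  reflected.\<close>

lemma dim_add_line:
  assumes W: "VectorSpace.subspace class_ring W V" and w: "w \<in> carrier_vec n" "w \<notin> W"
  shows "VectorSpace.subspace class_ring {v + c \<cdot>\<^sub>v w | v c. v \<in> W} V"
    and "vectorspace.dim class_ring (vs {v + c \<cdot>\<^sub>v w | v c. v \<in> W}) = vectorspace.dim class_ring (vs W) + 1"
proof -
  let ?U = "{v + c \<cdot>\<^sub>v w | v c. v \<in> W}"
  have W': "W \<subseteq> carrier_vec n" "0\<^sub>v n \<in> W" "\<And>v v'. v \<in> W \<Longrightarrow> v' \<in> W \<Longrightarrow> v + v' \<in> W"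
    "\<And>c v. v \<in> W \<Longrightarrow> c \<cdot>\<^sub>v v \<in> W"
    using W by (auto simp: subspace_iff)
  show U: "VectorSpace.subspace class_ring ?U V"
    unfolding subspace_iff
  proof (intro conjI ballI allI)
    show "?U \<subseteq> carrier_vec n"
      using W' w by auto
    have "0\<^sub>v n = 0\<^sub>v n + 0 \<cdot>\<^sub>v w"
      using w by auto
    then show "0\<^sub>v n \<in> ?U"
      using W' by blast
  next
    fix x y assume "x \<in> ?U" "y \<in> ?U"
    then obtain v c v' c' where *: "v \<in> W" "v' \<in> W" "x = v + c \<cdot>\<^sub>v w" "y = v' + c' \<cdot>\<^sub>v w"
      by blast
    then have "v \<in> carrier_vec n" "v' \<in> carrier_vec n"
      using W' by auto
    then have "x + y = (v + v') + (c + c') \<cdot>\<^sub>v w"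
      using w * by (intro eq_vecI) (auto simp: algebra_simps)
    then show "x + y \<in> ?U"
      using * W' by blast
  next
    fix a x assume "x \<in> ?U"
    then obtain v c where *: "v \<in> W" "x = v + c \<cdot>\<^sub>v w"
      by blast
    then have "v \<in> carrier_vec n"
      using W' by auto
    then have "a \<cdot>\<^sub>v x = a \<cdot>\<^sub>v v + (a * c) \<cdot>\<^sub>v w"
      using w * by (intro eq_vecI) (auto simp: algebra_simps)
    then show "a \<cdot>\<^sub>v x \<in> ?U"
      using * W' by blast
  qed
  obtain B where B: "finite B" "B \<subseteq> W" "lin_indpt B" "span B = W"
    "card B = vectorspace.dim class_ring (vs W)"
    by (rule subspace_basis[OF W])
  have Bc: "B \<subseteq> carrier_vec n" and wB: "w \<notin> B"
    using B W' w by auto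
  have "W \<subseteq> ?U"
  proof
    fix v assume "v \<in> W"
    moreover from this have "v = v + 0 \<cdot>\<^sub>v w"
      using W' w by auto
    ultimately show "v \<in> ?U"
      by blast
  qed
  moreover have "w = 0\<^sub>v n + 1 \<cdot>\<^sub>v w"
    using w by auto
  then have "w \<in> ?U"
    using W' by blast
  ultimately have sub: "insert w B \<subseteq> ?U"
    using B(2) by blast
  have "vectorspace.dim class_ring (vs ?U) = card (insert w B)"
  proof (rule subspace_dim_eq_card[OF U _ sub])
    show "finite (insert w B)"
      using B by simp
    show "lin_indpt (insert w B)"
      using lin_dep_iff_in_span[of B w] Bc B wB w by simp
    have S: "VectorSpace.subspace class_ring (span (insert w B)) V"
      using span_is_submodule[of "insert w B"] Bc w vec_vs by (simp add: VectorSpace.subspace_def)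
    have "w \<in> span (insert w B)" "W \<subseteq> span (insert w B)"
      using in_own_span[of "insert w B"] Bc w span_is_monotone[of B "insert w B"] B(4) by auto
    then have "?U \<subseteq> span (insert w B)"
      using S unfolding subspace_iff by auto
    moreover have "span (insert w B) \<subseteq> ?U"
      using span_is_subset[OF sub] U by (simp add: VectorSpace.subspace_def)
    ultimately show "span (insert w B) = ?U"
      by blast
  qed
  then show "vectorspace.dim class_ring (vs ?U) = vectorspace.dim class_ring (vs W) + 1"
    using B wB by simp
qed

text \<open>A basis of \<open>W\<close>, completed to a basis of the whole space, gives coordinates in which \<open>W\<close> is
  spanned by the first unit vectors.\<close>

lemma subspace_adapted_matrix:
  assumes W: "VectorSpace.subspace class_ring W V"
  defines "d \<equiv> vectorspace.dim class_ring (vs W)"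
  obtains P where "P \<in> carrier_mat n n" "det P \<noteq> 0"
    "\<And>j. j < d \<Longrightarrow> col P j \<in> W"
    "\<And>w. w \<in> W \<Longrightarrow> \<exists>x \<in> carrier_vec n. w = P *\<^sub>v x \<and> (\<forall>i. d \<le> i \<longrightarrow> i < n \<longrightarrow> x $ i = 0)"
proof -
  obtain B where B: "finite B" "B \<subseteq> W" "lin_indpt B" "span B = W" "card B = d"
    unfolding d_def by (rule subspace_basis[OF W])
  have Bc: "B \<subseteq> carrier_vec n"
    using B W by (auto simp: subspace_iff)
  have V: "VectorSpace.subspace class_ring (carrier_vec n) V"
    by (auto simp: subspace_iff)
  obtain C where C: "finite C" "B \<subseteq> C" "C \<subseteq> carrier_vec n" "lin_indpt C" "card C = n"
  proof -
    have "vectorspace.dim class_ring (vs (carrier_vec n)) = n"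
      using carrier_vs_is_self dim_is_n by (simp flip: cV)
    then show thesis
      using subspace_basis_exists[OF V Bc B(3)] that by metis
  qed
  obtain us where us: "distinct us" "set us = B"
    using B(1) finite_distinct_list by blast
  obtain ws where ws: "distinct ws" "set ws = C - B"
    using C(1) finite_distinct_list by blast
  have dist: "distinct (us @ ws)" and set: "set (us @ ws) = C"
    using us ws C by auto
  have len: "length us = d" "length (us @ ws) = n"
    using us B(5) distinct_card[OF dist] set C(5) distinct_card[OF us(1)] by auto
  define P where "P = mat_of_cols n (us @ ws)"
  have P: "P \<in> carrier_mat n n"
    using mat_of_cols_carrier(1)[of n "us @ ws"] len(2) unfolding P_def by metis
  have cols: "cols P = us @ ws"
    unfolding P_def using set C by (intro cols_mat_of_cols) auto
  have "rank P = n"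
    using lin_indpt_full_rank[OF P] cols dist set C by simp
  then have det: "det P \<noteq> 0"
    using det_rank_iff[OF P] by simp
  have col: "col P j = us ! j" if "j < d" for j
  proof -
    have "cols P ! j = col P j"
      using that len P by (intro cols_nth) auto
    then show ?thesis
      using that len(1) unfolding cols by (simp add: nth_append)
  qed
  let ?E = "{x \<in> carrier_vec n. \<forall>i. d \<le> i \<longrightarrow> i < n \<longrightarrow> x $ i = 0}"
  have "VectorSpace.subspace class_ring ?E V"
    by (auto simp: subspace_iff)
  then have E: "VectorSpace.subspace class_ring ((*\<^sub>v) P ` ?E) V"
    by (rule subspace_image[OF _ P])
  have "B \<subseteq> (*\<^sub>v) P ` ?E"
  proof
    fix b assume "b \<in> B"
    then obtain j where j: "j < d" "b = us ! j"
      using us len by (metis in_set_conv_nth)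
    moreover have jn: "j < n"
      using j len by simp
    have "P *\<^sub>v unit_vec n j = col P j"
      using P jn mult_unit_vec_index[OF P _ jn] by (intro eq_vecI) auto
    moreover have "unit_vec n j \<in> ?E"
      using j jn by auto
    moreover have "b = col P j"
      using j col by simp
    ultimately have "b = P *\<^sub>v unit_vec n j" "unit_vec n j \<in> ?E"
      by simp_all
    then show "b \<in> (*\<^sub>v) P ` ?E"
      by (rule image_eqI)
  qed
  then have "W \<subseteq> (*\<^sub>v) P ` ?E"
    using span_is_subset[of B "(*\<^sub>v) P ` ?E"] E B(4) by (simp add: VectorSpace.subspace_def)
  then have "\<exists>x \<in> carrier_vec n. w = P *\<^sub>v x \<and> (\<forall>i. d \<le> i \<longrightarrow> i < n \<longrightarrow> x $ i = 0)" if "w \<in> W" for w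
    using that by blast
  moreover have "col P j \<in> W" if "j < d" for j
    using col[OF that] us B(2) len that by (metis nth_mem subsetD)
  ultimately show thesis
    using that[OF P det] by blast
qed

end

text \<open>Sylvester's identity. The block matrix with rows \<open>(1, U)\<close> and \<open>(- W, 1)\<close> factors into
  triangular block matrices in two orders. It is used with \<open>m = 1\<close>, for the determinant of a
  rank-one perturbation of the identity.\<close>

lemma det_one_plus_mult_commute:
  fixes U W :: "'a :: idom mat"
  assumes U: "U \<in> carrier_mat n m" and W: "W \<in> carrier_mat m n"
  shows "det (1\<^sub>m n + U * W) = det (1\<^sub>m m + W * U)"
proof -
  define L where "L = four_block_mat (1\<^sub>m n) (0\<^sub>m n m) (- W) (1\<^sub>m m)"
  define A where "A = four_block_mat (1\<^sub>m n) U (0\<^sub>m m n) (1\<^sub>m m + W * U)"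
  define B where "B = four_block_mat (1\<^sub>m n + U * W) U (0\<^sub>m m n) (1\<^sub>m m)"
  have car: "L \<in> carrier_mat (n + m) (n + m)" "A \<in> carrier_mat (n + m) (n + m)" "B \<in> carrier_mat (n + m) (n + m)"
    using U W by (auto simp: L_def A_def B_def)
  have "L * A = four_block_mat (1\<^sub>m n) U (- W) (1\<^sub>m m)"
    unfolding L_def A_def using U W
    by (subst mult_four_block_mat[of _ n n _ m _ m]) (auto intro!: arg_cong4[of _ _ _ _ _ _ _ _ four_block_mat] eq_matI)
  also have "\<dots> = B * L"
    unfolding L_def B_def using U W
    by (subst mult_four_block_mat[of _ n n _ m _ m]) (auto intro!: arg_cong4[of _ _ _ _ _ _ _ _ four_block_mat] eq_matI)
  finally have "det L * det A = det B * det L"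
    using car by (simp flip: det_mult)
  moreover have "det L = 1"
    unfolding L_def using W by (subst det_four_block_mat_upper_right_zero[of _ n _ m]) auto
  moreover have "det A = det (1\<^sub>m m + W * U)"
    unfolding A_def using U W by (subst det_four_block_mat_lower_left_zero[of _ n _ m]) auto
  moreover have "det B = det (1\<^sub>m n + U * W)"
    unfolding B_def using U W by (subst det_four_block_mat_lower_left_zero[of _ n _ m]) auto
  ultimately show ?thesis
    by simp
qed

section \<open>Isometries and Lagrangian subspaces\<close>

lemma mat_eq_of_bilinear_eq:
  fixes A B :: "complex mat"
  assumes A: "A \<in> carrier_mat n n" and B: "B \<in> carrier_mat n n"
    and eq: "\<And>v w. v \<in> carrier_vec n \<Longrightarrow> w \<in> carrier_vec n \<Longrightarrow> v \<bullet> (A *\<^sub>v w) = v \<bullet> (B *\<^sub>v w)"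
  shows "A = B"
proof (rule eq_matI)
  fix i j assume "i < dim_row B" "j < dim_col B"
  then have ij: "i < n" "j < n"
    using B by auto
  have *: "unit_vec n i \<bullet> (M *\<^sub>v unit_vec n j) = M $$ (i, j)" if "M \<in> carrier_mat n n" for M :: "complex mat"
    using that ij by (subst scalar_prod_left_unit[of _ n]) (auto simp: mult_unit_vec_index simp del: index_mult_mat_vec)
  show "A $$ (i, j) = B $$ (i, j)"
    using eq[of "unit_vec n i" "unit_vec n j"] *[OF A] *[OF B] by simp
qed (use A B in auto)

definition isometry :: "nat \<Rightarrow> complex mat \<Rightarrow> complex mat \<Rightarrow> bool" where
  "isometry n S g \<longleftrightarrow> g \<in> carrier_mat n n \<and> transpose_mat g * S * g = S"

definition lagrangian :: "nat \<Rightarrow> complex mat \<Rightarrow> complex vec set \<Rightarrow> bool" where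
  "lagrangian n S L \<longleftrightarrow> VectorSpace.subspace class_ring L (Vec n) \<and> perp n S L = L"

text \<open>Symmetric forms are the case \<open>\<epsilon> = 1\<close> and skew forms the case \<open>\<epsilon> = - 1\<close>. Keeping \<open>\<epsilon>\<close> as a
  parameter lets one argument serve the orthogonal and the symplectic groups.\<close>

locale eps_symmetric_form =
  fixes n :: nat and S :: "complex mat" and \<epsilon> :: complex
  assumes S: "S \<in> carrier_mat n n"
    and eps_square: "\<epsilon> * \<epsilon> = 1"
    and transpose_S: "transpose_mat S = \<epsilon> \<cdot>\<^sub>m S"
    and nondegenerate: "det S \<noteq> 0"
begin

sublocale vec_space "TYPE(complex)" n .

lemma form_add_left:
  "u \<in> carrier_vec n \<Longrightarrow> v \<in> carrier_vec n \<Longrightarrow> w \<in> carrier_vec n \<Longrightarrow> form S (u + v) w = form S u w + form S v w"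
  using S by (simp add: form_def add_scalar_prod_distrib[of _ n])

lemma form_add_right:
  "u \<in> carrier_vec n \<Longrightarrow> v \<in> carrier_vec n \<Longrightarrow> w \<in> carrier_vec n \<Longrightarrow> form S w (u + v) = form S w u + form S w v"
  using S by (simp add: form_def mult_add_distrib_mat_vec[of _ n n] scalar_prod_add_distrib[of _ n])

lemma form_smult_left:
  "v \<in> carrier_vec n \<Longrightarrow> w \<in> carrier_vec n \<Longrightarrow> form S (c \<cdot>\<^sub>v v) w = c * form S v w"
  using S by (simp add: form_def)

lemma form_smult_right:
  "v \<in> carrier_vec n \<Longrightarrow> w \<in> carrier_vec n \<Longrightarrow> form S w (c \<cdot>\<^sub>v v) = c * form S w v"
  using S by (simp add: form_def mult_mat_vec[of _ n n])

lemmas form_linear = form_add_left form_add_right form_smult_left form_smult_right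

lemma form_swap:
  assumes "v \<in> carrier_vec n" "w \<in> carrier_vec n"
  shows "form S w v = \<epsilon> * form S v w"
proof -
  have "form S w v = (transpose_mat S *\<^sub>v w) \<bullet> v"
    unfolding form_def using transpose_vec_mult_scalar[OF S assms] by simp
  also have "\<dots> = \<epsilon> * ((S *\<^sub>v w) \<bullet> v)"
  proof -
    have "(\<epsilon> \<cdot>\<^sub>m S) *\<^sub>v w = \<epsilon> \<cdot>\<^sub>v (S *\<^sub>v w)"
      using S assms by (intro eq_vecI) auto
    then show ?thesis
      using S assms by (simp add: transpose_S)
  qed
  also have "(S *\<^sub>v w) \<bullet> v = form S v w"
    unfolding form_def using S assms by (intro comm_scalar_prod[of _ n]) auto
  finally show ?thesis .
qed

lemma form_mult:
  assumes "g \<in> carrier_mat n n" "v \<in> carrier_vec n" "w \<in> carrier_vec n"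
  shows "form S (g *\<^sub>v v) (g *\<^sub>v w) = v \<bullet> (transpose_mat g * S * g *\<^sub>v w)"
proof -
  have "form S (g *\<^sub>v v) (g *\<^sub>v w) = v \<bullet> (transpose_mat g *\<^sub>v (S *\<^sub>v (g *\<^sub>v w)))"
    unfolding form_def using assms S transpose_vec_mult_scalar[of "transpose_mat g" n n _ v] by simp
  then show ?thesis
    using assms S by (simp add: assoc_mult_mat_vec[of _ n n _ n])
qed

lemma isometry_iff_form:
  "isometry n S g \<longleftrightarrow> g \<in> carrier_mat n n \<and>
     (\<forall>v \<in> carrier_vec n. \<forall>w \<in> carrier_vec n. form S (g *\<^sub>v v) (g *\<^sub>v w) = form S v w)"
proof (cases "g \<in> carrier_mat n n")
  case True
  then have "transpose_mat g * S * g \<in> carrier_mat n n"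
    by auto
  then show ?thesis
    using True S mat_eq_of_bilinear_eq[OF _ S] form_mult[OF True]
    by (auto simp: isometry_def form_def)
qed (simp add: isometry_def)

lemma isometry_carrier: "isometry n S g \<Longrightarrow> g \<in> carrier_mat n n"
  by (simp add: isometry_def)

lemma isometry_form:
  "isometry n S g \<Longrightarrow> v \<in> carrier_vec n \<Longrightarrow> w \<in> carrier_vec n \<Longrightarrow> form S (g *\<^sub>v v) (g *\<^sub>v w) = form S v w"
  by (simp add: isometry_iff_form)

lemma isometry_one: "isometry n S (1\<^sub>m n)"
  using S by (simp add: isometry_def)

lemma isometry_mult:
  assumes "isometry n S g" "isometry n S g'"
  shows "isometry n S (g * g')"
  using assms by (auto simp: isometry_iff_form assoc_mult_mat_vec[of _ n n _ n])

lemma isometry_det: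
  assumes "isometry n S g"
  shows "det g = 1 \<or> det g = - 1"
proof -
  have g: "g \<in> carrier_mat n n" "transpose_mat g * S * g = S"
    using assms by (auto simp: isometry_def)
  have "det (transpose_mat g * S * g) = det g * det S * det g"
    using S g(1) by (simp add: det_mult[of _ n] det_transpose[of _ n])
  then have "det g * det g = 1"
    using nondegenerate unfolding g(2) by simp
  then show ?thesis
    by (simp add: square_eq_1_iff)
qed

lemma isometry_inverse:
  assumes "isometry n S g"
  obtains g' where "isometry n S g'" "g * g' = 1\<^sub>m n" "g' * g = 1\<^sub>m n"
proof -
  have g: "g \<in> carrier_mat n n" "det g \<noteq> 0"
    using assms isometry_det[OF assms] by (auto simp: isometry_def)
  obtain g' where g': "g' \<in> carrier_mat n n" "g * g' = 1\<^sub>m n" "g' * g = 1\<^sub>m n"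
    using det_nonzero_inverse[OF g] by blast
  have "form S (g' *\<^sub>v v) (g' *\<^sub>v w) = form S v w" if "v \<in> carrier_vec n" "w \<in> carrier_vec n" for v w
    using isometry_form[OF assms, of "g' *\<^sub>v v" "g' *\<^sub>v w"] that g'
    by (simp add: mult_inverse_mat_vec[OF g(1) g'(1,2)])
  then have "isometry n S g'"
    using g'(1) by (simp add: isometry_iff_form)
  then show thesis
    using that g' by blast
qed

lemma perp_image:
  assumes g: "isometry n S g" and W: "W \<subseteq> carrier_vec n"
  shows "perp n S ((*\<^sub>v) g ` W) = (*\<^sub>v) g ` perp n S W"
proof (intro subset_antisym subsetI)
  note gc = isometry_carrier[OF g]
  obtain g' where g': "isometry n S g'" "g * g' = 1\<^sub>m n"
    using isometry_inverse[OF g] by blast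
  note g'c = isometry_carrier[OF g'(1)]
  fix x assume x: "x \<in> perp n S ((*\<^sub>v) g ` W)"
  then have xc: "x \<in> carrier_vec n"
    by (simp add: perp_def)
  have gx: "g *\<^sub>v (g' *\<^sub>v x) = x"
    by (rule mult_inverse_mat_vec[OF gc g'c g'(2) xc])
  have "form S (g' *\<^sub>v x) w = 0" if "w \<in> W" for w
  proof -
    have "form S (g *\<^sub>v (g' *\<^sub>v x)) (g *\<^sub>v w) = 0"
      using x that unfolding gx by (auto simp: perp_def)
    then show ?thesis
      using isometry_form[OF g, of "g' *\<^sub>v x" w] that W g'c xc by auto
  qed
  then have "g' *\<^sub>v x \<in> perp n S W"
    using g'c xc by (simp add: perp_def)
  then show "x \<in> (*\<^sub>v) g ` perp n S W"
    using gx by (metis imageI)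
next
  fix x assume "x \<in> (*\<^sub>v) g ` perp n S W"
  then show "x \<in> perp n S ((*\<^sub>v) g ` W)"
    using isometry_carrier[OF g] isometry_form[OF g] W by (auto simp: perp_def subset_iff)
qed

lemma lagrangian_image:
  assumes "isometry n S g" "lagrangian n S L"
  shows "lagrangian n S ((*\<^sub>v) g ` L)"
  using assms subspace_image perp_image isometry_carrier
  by (simp add: lagrangian_def subspace_iff)

lemma lagrangian_form_zero:
  "lagrangian n S L \<Longrightarrow> u \<in> L \<Longrightarrow> v \<in> L \<Longrightarrow> form S u v = 0"
  unfolding lagrangian_def perp_def by blast

lemma lagrangian_eq_of_form_zero:
  assumes L: "lagrangian n S L" and M: "lagrangian n S M"
    and zero: "\<And>u w. u \<in> L \<Longrightarrow> w \<in> M \<Longrightarrow> form S u w = 0"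
  shows "L = M"
proof
  have car: "L \<subseteq> carrier_vec n" "M \<subseteq> carrier_vec n"
    using L M by (auto simp: lagrangian_def subspace_iff)
  have "L \<subseteq> perp n S M"
    using zero car by (auto simp: perp_def)
  then show "L \<subseteq> M"
    using M by (simp add: lagrangian_def)
  have "form S w u = 0" if "u \<in> L" "w \<in> M" for u w
    using form_swap[of u w] zero[OF that] car that by auto
  then have "M \<subseteq> perp n S L"
    using car by (auto simp: perp_def)
  then show "M \<subseteq> L"
    using L by (simp add: lagrangian_def)
qed

text \<open>The map \<open>x \<mapsto> x + B(x, v) v\<close>, where \<open>B\<close> is the form of \<open>S\<close>. For a symmetric form and
  \<open>B(v, v) = - 2\<close> it is the orthogonal reflection in \<open>v\<close>, for a skew form it is a symplectic
  transvection.\<close>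

definition reflection :: "complex vec \<Rightarrow> complex mat" where
  "reflection v = 1\<^sub>m n + mat n 1 (\<lambda>(i, _). v $ i) * mat 1 n (\<lambda>(_, j). (S *\<^sub>v v) $ j)"

lemma reflection_carrier: "reflection v \<in> carrier_mat n n"
  by (auto simp: reflection_def)

lemma reflection_apply:
  assumes v: "v \<in> carrier_vec n" and x: "x \<in> carrier_vec n"
  shows "reflection v *\<^sub>v x = x + form S x v \<cdot>\<^sub>v v"
proof -
  let ?U = "mat n 1 (\<lambda>(i, _). v $ i)" and ?W = "mat 1 n (\<lambda>(_, j). (S *\<^sub>v v) $ j)"
  have "?W *\<^sub>v x = vec 1 (\<lambda>_. form S x v)"
    using S v x comm_scalar_prod[of x n "S *\<^sub>v v"]
    by (intro eq_vecI) (auto simp: form_def row_def scalar_prod_def)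
  then have "?U *\<^sub>v (?W *\<^sub>v x) = form S x v \<cdot>\<^sub>v v"
    using v by (intro eq_vecI) (auto simp: scalar_prod_def)
  moreover have "?U * ?W *\<^sub>v x = ?U *\<^sub>v (?W *\<^sub>v x)"
    using x by (intro assoc_mult_mat_vec[of _ n 1 _ n]) auto
  ultimately show ?thesis
    unfolding reflection_def using x by (subst add_mult_distrib_mat_vec[of _ n n]) auto
qed

lemma det_reflection:
  assumes v: "v \<in> carrier_vec n"
  shows "det (reflection v) = 1 + form S v v"
proof -
  let ?U = "mat n 1 (\<lambda>(i, _). v $ i)" and ?W = "mat 1 n (\<lambda>(_, j). (S *\<^sub>v v) $ j)"
  have "det (reflection v) = det (1\<^sub>m 1 + ?W * ?U)"
    unfolding reflection_def by (rule det_one_plus_mult_commute) auto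
  also have "\<dots> = 1 + (?W * ?U) $$ (0, 0)"
    by (subst det_single) auto
  also have "(?W * ?U) $$ (0, 0) = (S *\<^sub>v v) \<bullet> v"
    using v S by (auto simp: scalar_prod_def)
  also have "\<dots> = form S v v"
    unfolding form_def using v S by (intro comm_scalar_prod[of _ n]) auto
  finally show ?thesis .
qed

lemma isometry_reflection:
  assumes v: "v \<in> carrier_vec n" and "form S v v = - 1 - \<epsilon>"
  shows "isometry n S (reflection v)"
proof -
  have "form S (reflection v *\<^sub>v x) (reflection v *\<^sub>v y) = form S x y"
    if xy: "x \<in> carrier_vec n" "y \<in> carrier_vec n" for x y
  proof -
    have "form S (reflection v *\<^sub>v x) (reflection v *\<^sub>v y) =
        form S x y + form S y v * form S x v + form S x v * form S v y + form S x v * form S y v * form S v v"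
      using v xy by (simp add: reflection_apply form_linear algebra_simps)
    also have "\<dots> = form S x y + form S x v * form S y v * (1 + \<epsilon> + form S v v)"
      using form_swap[of y v] v xy by (simp add: algebra_simps)
    finally show ?thesis
      using assms(2) by simp
  qed
  then show ?thesis
    by (simp add: isometry_iff_form reflection_carrier)
qed

lemma eps_cases: "\<epsilon> = 1 \<or> \<epsilon> = - 1"
  using eps_square by (simp add: square_eq_1_iff)

text \<open>If \<open>L \<noteq> M\<close> there are \<open>u \<in> L\<close> and \<open>w \<in> M\<close> with \<open>B(u, w) = 1\<close>. The reflection in \<open>u - w\<close> is
  an isometry of determinant \<open>- \<epsilon>\<close>, sends \<open>u\<close> to \<open>w\<close> and fixes \<open>L \<inter> M\<close>, and the image of \<open>L\<close>
  meets \<open>M\<close> in \<open>L \<inter> M\<close> extended by the line of \<open>w\<close>. Hence each reflection raises the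
  dimension of the intersection by one, and \<open>dim M - dim (L \<inter> M)\<close> of them carry \<open>L\<close> to \<open>M\<close>;
  the exponent has the parity of this number.\<close>

lemma lagrangians_connected:
  assumes "lagrangian n S L" "lagrangian n S M"
  obtains r where "isometry n S r" "(*\<^sub>v) r ` L = M"
    "det r = (- \<epsilon>) ^ (subspace_dim n (L \<inter> M) + subspace_dim n M)"
proof -
  have "\<exists>r. isometry n S r \<and> (*\<^sub>v) r ` L = M \<and> det r = (- \<epsilon>) ^ (subspace_dim n (L \<inter> M) + subspace_dim n M)"
    using assms(1)
  \<comment> \<open>The reflected subspace meets \<open>M\<close> in a larger dimension, which is bounded by \<open>n\<close>.\<close>
  proof (induction "n - subspace_dim n (L \<inter> M)" arbitrary: L rule: less_induct)
    case less
    note L = less.prems and M = assms(2)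
    have sub: "VectorSpace.subspace class_ring L V" "VectorSpace.subspace class_ring M V"
      using L M by (auto simp: lagrangian_def)
    then have LM: "L \<subseteq> carrier_vec n" "M \<subseteq> carrier_vec n"
      by (auto simp: subspace_iff)
    show ?case
    proof (cases "L = M")
      case True
      have "(*\<^sub>v) (1\<^sub>m n) ` M = M"
        using LM by (auto simp: image_def subset_iff)
      then show ?thesis
        using True isometry_one eps_cases by (auto intro!: exI[of _ "1\<^sub>m n"] simp: power_add)
    next
      case False
      then obtain u' w where uw': "u' \<in> L" "w \<in> M" "form S u' w \<noteq> 0"
        using lagrangian_eq_of_form_zero[OF L M] by blast
      define u where "u = (1 / form S u' w) \<cdot>\<^sub>v u'"
      have w: "w \<in> M" "w \<in> carrier_vec n" and "u' \<in> carrier_vec n"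
        using uw' LM by auto
      then have u: "u \<in> L" "form S u w = 1" "u \<in> carrier_vec n"
        using uw' sub by (auto simp: u_def form_smult_left subspace_iff)
      define v where "v = u + (- 1) \<cdot>\<^sub>v w"
      have v: "v \<in> carrier_vec n"
        using u w by (simp add: v_def)
      have "form S v v = - 1 - \<epsilon>"
        using u w lagrangian_form_zero[OF L u(1) u(1)] lagrangian_form_zero[OF M w(1) w(1)] form_swap[of u w]
        by (simp add: v_def form_linear)
      note R = isometry_reflection[OF v this] and det_R = det_reflection[OF v, unfolded this]
      define R where "R = reflection v"
      have R_apply: "R *\<^sub>v x = x + form S x v \<cdot>\<^sub>v v" if "x \<in> carrier_vec n" for x
        using reflection_apply[OF v that] by (simp add: R_def)
      define D where "D = L \<inter> M"
      have D: "VectorSpace.subspace class_ring D V"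
        using sub by (auto simp: subspace_iff D_def)
      have wD: "w \<notin> D"
        using lagrangian_form_zero[OF L u(1)] u by (auto simp: D_def)
      let ?L = "(*\<^sub>v) R ` L"
      have RL: "lagrangian n S ?L"
        unfolding R_def by (rule lagrangian_image[OF R L])
      have RL_sub: "VectorSpace.subspace class_ring ?L V"
        using RL by (simp add: lagrangian_def)
      have "R *\<^sub>v u = u + (form S u u - form S u w) \<cdot>\<^sub>v v"
        using u w by (simp add: R_apply v_def form_linear)
      also have "\<dots> = w"
        using u w lagrangian_form_zero[OF L u(1) u(1)] by (intro eq_vecI) (auto simp: v_def)
      finally have "w \<in> ?L"
        using u by (metis imageI)
      have D_RL: "d \<in> ?L" if "d \<in> D" for d
      proof -
        have d: "d \<in> L" "d \<in> M" "d \<in> carrier_vec n"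
          using that LM by (auto simp: D_def)
        have "form S d v = 0"
          using d u w lagrangian_form_zero[OF L d(1) u(1)] lagrangian_form_zero[OF M d(2) w(1)]
          by (simp add: v_def form_linear)
        then have "R *\<^sub>v d = d"
          using d v by (auto simp: R_apply)
        then show ?thesis
          using d by (metis imageI)
      qed
      have "{d + c \<cdot>\<^sub>v w | d c. d \<in> D} \<subseteq> ?L \<inter> M"
      proof safe
        fix d c assume d: "d \<in> D"
        show "d + c \<cdot>\<^sub>v w \<in> ?L"
          by (rule subspace_add[OF RL_sub D_RL[OF d] subspace_smult[OF RL_sub \<open>w \<in> ?L\<close>]])
        show "d + c \<cdot>\<^sub>v w \<in> M"
          using d by (intro subspace_add[OF sub(2)] subspace_smult[OF sub(2) w(1)]) (simp add: D_def)
      qed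
      moreover have "?L \<inter> M \<subseteq> {d + c \<cdot>\<^sub>v w | d c. d \<in> D}"
      proof
        fix y assume "y \<in> ?L \<inter> M"
        then obtain x where x: "x \<in> L" "y = R *\<^sub>v x" "y \<in> M"
          by blast
        define c where "c = form S x v"
        have xc: "x \<in> carrier_vec n"
          using x LM by auto
        have "y = x + c \<cdot>\<^sub>v v"
          by (simp add: x(2) R_apply[OF xc] c_def)
        then have y: "y = (x + c \<cdot>\<^sub>v u) + (- c) \<cdot>\<^sub>v w"
          unfolding v_def using xc u w by (intro eq_vecI) (auto simp: algebra_simps)
        then have "x + c \<cdot>\<^sub>v u = y + c \<cdot>\<^sub>v w"
          using xc u w by (intro eq_vecI) auto
        moreover have "y + c \<cdot>\<^sub>v w \<in> M" "x + c \<cdot>\<^sub>v u \<in> L"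
          using x u w sub by (auto simp: subspace_iff)
        ultimately have "x + c \<cdot>\<^sub>v u \<in> D"
          by (simp add: D_def)
        then show "y \<in> {d + c \<cdot>\<^sub>v w | d c. d \<in> D}"
          using y by blast
      qed
      ultimately have "?L \<inter> M = {d + c \<cdot>\<^sub>v w | d c. d \<in> D}"
        by blast
      then have dim: "subspace_dim n (?L \<inter> M) = subspace_dim n D + 1"
        using dim_add_line(2)[OF D w(2) wD] by (simp add: subspace_dim_def)
      have "VectorSpace.subspace class_ring (?L \<inter> M) V"
        using RL_sub sub by (auto simp: subspace_iff)
      then have "subspace_dim n (?L \<inter> M) \<le> n"
        using subspace_dim_le by (simp add: subspace_dim_def)
      then have "n - subspace_dim n (?L \<inter> M) < n - subspace_dim n (L \<inter> M)"
        using dim by (simp add: D_def)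
      from less.hyps[OF this RL] obtain r where r: "isometry n S r" "(*\<^sub>v) r ` ?L = M"
        "det r = (- \<epsilon>) ^ (subspace_dim n (?L \<inter> M) + subspace_dim n M)"
        by blast
      have rc: "r \<in> carrier_mat n n" "R \<in> carrier_mat n n"
        using r isometry_carrier reflection_carrier by (auto simp: R_def)
      have "(*\<^sub>v) (r * R) ` L = (*\<^sub>v) r ` ?L"
        unfolding image_image using rc LM by (intro image_cong) (auto simp: assoc_mult_mat_vec[of _ n n _ n])
      moreover have "det (r * R) = (- \<epsilon>) ^ (subspace_dim n (L \<inter> M) + subspace_dim n M)"
        using det_mult[OF rc] r(3) det_R dim eps_square by (simp add: R_def[symmetric] D_def)
      ultimately show ?thesis
        using isometry_mult[OF r(1) R] r(2) unfolding R_def by metis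
    qed
  qed
  then show thesis
    using that by blast
qed

end

section \<open>Determinants of isometries\<close>

lemma transpose_smult_mat: "transpose_mat (c \<cdot>\<^sub>m A) = c \<cdot>\<^sub>m transpose_mat A"
  by (intro eq_matI) auto

lemma four_block_mat_upper_right_eq:
  assumes "four_block_mat A B C D = four_block_mat A' B' C' D'"
    and "A \<in> carrier_mat n m" "A' \<in> carrier_mat n m" "B \<in> carrier_mat n k" "B' \<in> carrier_mat n k"
    and "C \<in> carrier_mat l m" "C' \<in> carrier_mat l m" "D \<in> carrier_mat l k" "D' \<in> carrier_mat l k"
  shows "B = B'"
proof (rule eq_matI)
  fix i j assume "i < dim_row B'" "j < dim_col B'"
  then show "B $$ (i, j) = B' $$ (i, j)"
    using arg_cong[OF assms(1), of "\<lambda>M. M $$ (i, j + m)"] assms(2-) by simp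
qed (use assms in auto)

text \<open>The isometry \<open>T\<close> of the form \<open>M\<close> stabilises the totally isotropic span of the first half
  of the basis. The upper right block of the isometry condition reads \<open>A\<^sup>T U D = U\<close>; since
  \<open>det U \<noteq> 0\<close>, the determinants of the diagonal blocks of \<open>T\<close> are inverse to each other.\<close>

lemma det_block_isometry:
  fixes A B D U V W :: "'a :: idom mat"
  assumes car: "A \<in> carrier_mat m m" "B \<in> carrier_mat m m" "D \<in> carrier_mat m m"
      "U \<in> carrier_mat m m" "V \<in> carrier_mat m m" "W \<in> carrier_mat m m"
    and T: "T = four_block_mat A B (0\<^sub>m m m) D" and M: "M = four_block_mat (0\<^sub>m m m) U V W"
    and isometry: "transpose_mat T * M * T = M" and det: "det M \<noteq> 0"
  shows "det T = 1"
proof -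
  define Z where "Z = transpose_mat B * U + transpose_mat D * W"
  have car': "transpose_mat A \<in> carrier_mat m m" "transpose_mat B \<in> carrier_mat m m" "transpose_mat D \<in> carrier_mat m m"
      "transpose_mat A * U \<in> carrier_mat m m" "transpose_mat D * V \<in> carrier_mat m m" "Z \<in> carrier_mat m m"
      "0\<^sub>m m m \<in> carrier_mat m m"
    using car by (auto simp: Z_def)
  have "transpose_mat T = four_block_mat (transpose_mat A) (0\<^sub>m m m) (transpose_mat B) (transpose_mat D)"
    unfolding T by (subst transpose_four_block_mat[OF car(1,2) car'(7) car(3)]) simp
  then have "transpose_mat T * M = four_block_mat (0\<^sub>m m m) (transpose_mat A * U) (transpose_mat D * V) Z"
    unfolding M Z_def using car car'
    by (simp add: mult_four_block_mat[OF car'(1,7,2,3,7) car(4-6)])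
  then have "transpose_mat T * M * T = four_block_mat (0\<^sub>m m m * A + transpose_mat A * U * 0\<^sub>m m m)
      (0\<^sub>m m m * B + transpose_mat A * U * D) (transpose_mat D * V * A + Z * 0\<^sub>m m m) (transpose_mat D * V * B + Z * D)"
    unfolding T by (simp only: mult_four_block_mat[OF car'(7,4,5,6) car(1,2) car'(7) car(3)])
  then have "four_block_mat (0\<^sub>m m m * A + transpose_mat A * U * 0\<^sub>m m m)
      (0\<^sub>m m m * B + transpose_mat A * U * D) (transpose_mat D * V * A + Z * 0\<^sub>m m m) (transpose_mat D * V * B + Z * D)
      = four_block_mat (0\<^sub>m m m) U V W"
    using isometry M by simp
  then have "0\<^sub>m m m * B + transpose_mat A * U * D = U"
    by (rule four_block_mat_upper_right_eq[of _ _ _ _ _ _ _ _ m m m m]) (use car car' in auto)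
  then have "transpose_mat A * U * D = U"
    using car car' by simp
  then have "det (transpose_mat A * U * D) = det U"
    by simp
  then have 1: "det A * det U * det D = det U"
    using car by (simp add: det_mult[of _ m] det_transpose[of _ m])
  \<comment> \<open>Swapping the two halves of the basis makes \<open>M\<close> block triangular, which shows that \<open>det U \<noteq> 0\<close>.\<close>
  define J :: "'a mat" where "J = four_block_mat (0\<^sub>m m m) (1\<^sub>m m) (1\<^sub>m m) (0\<^sub>m m m)"
  have J: "J \<in> carrier_mat (m + m) (m + m)"
    by (simp add: J_def)
  have "J * J = 1\<^sub>m (m + m)"
    unfolding J_def by (subst mult_four_block_mat[of _ m m _ m _ m]) auto
  then have "det J * det J = 1"
    using det_mult[OF J J] by simp
  then have "det J \<noteq> 0"
    by auto
  moreover have "M * J = four_block_mat U (0\<^sub>m m m) W V"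
    unfolding M J_def using car by (subst mult_four_block_mat[of _ m m _ m _ m]) auto
  then have "det (M * J) = det U * det V"
    using car by (simp add: det_four_block_mat_upper_right_zero[of _ m _ m])
  moreover have "det (M * J) = det M * det J"
    using car J M by (intro det_mult) auto
  ultimately have "det U \<noteq> 0"
    using det by auto
  then have "det A * det D = 1"
    using 1 by (simp add: algebra_simps)
  then show ?thesis
    unfolding T using car by (simp add: det_four_block_mat_lower_left_zero[of _ m _ m])
qed

context eps_symmetric_form
begin

text \<open>In a basis that begins with a basis of \<open>L\<close>, the isometry is block triangular and the form
  has a zero block.\<close>

lemma det_lagrangian_stabilizer:
  assumes n: "n = 2 * m" and L: "lagrangian n S L" "subspace_dim n L = m"
    and g: "isometry n S g" and gL: "(*\<^sub>v) g ` L \<subseteq> L"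
  shows "det g = 1"
proof -
  have L_sub: "VectorSpace.subspace class_ring L V"
    using L by (simp add: lagrangian_def)
  have dim: "vectorspace.dim class_ring (vs L) = m"
    using L by (simp add: subspace_dim_def)
  obtain P where P: "P \<in> carrier_mat n n" "det P \<noteq> 0" and col: "\<And>j. j < m \<Longrightarrow> col P j \<in> L"
    and coords: "\<And>w. w \<in> L \<Longrightarrow> \<exists>x \<in> carrier_vec n. w = P *\<^sub>v x \<and> (\<forall>i. m \<le> i \<longrightarrow> i < n \<longrightarrow> x $ i = 0)"
    using subspace_adapted_matrix[OF L_sub] unfolding dim by blast
  obtain Q where Q: "Q \<in> carrier_mat n n" "P * Q = 1\<^sub>m n" "Q * P = 1\<^sub>m n"
    using det_nonzero_inverse[OF P] by blast
  note gc = isometry_carrier[OF g]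
  define T where "T = Q * g * P"
  define M where "M = transpose_mat P * S * P"
  have T: "T \<in> carrier_mat n n" and M: "M \<in> carrier_mat n n"
    using P Q gc S by (auto simp: T_def M_def)
  have P_unit: "P *\<^sub>v unit_vec n j = col P j" if "j < n" for j
    using P that mult_unit_vec_index[OF P(1) _ that] by (intro eq_vecI) auto
  have T0: "T $$ (i, j) = 0" if ij: "m \<le> i" "i < n" "j < m" for i j
  proof -
    have jn: "j < n"
      using ij n by simp
    obtain x where x: "x \<in> carrier_vec n" "g *\<^sub>v col P j = P *\<^sub>v x" "\<forall>i. m \<le> i \<longrightarrow> i < n \<longrightarrow> x $ i = 0"
      using coords[of "g *\<^sub>v col P j"] col[OF ij(3)] gL by blast
    have "T *\<^sub>v unit_vec n j = Q *\<^sub>v (g *\<^sub>v (P *\<^sub>v unit_vec n j))"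
      unfolding T_def using P Q gc by (simp add: assoc_mult_mat_vec[of _ n n _ n])
    also have "\<dots> = x"
      unfolding P_unit[OF jn] x(2) by (rule mult_inverse_mat_vec[OF Q(1) P(1) Q(3) x(1)])
    finally show ?thesis
      using mult_unit_vec_index[OF T ij(2) jn] x ij by simp
  qed
  have M0: "M $$ (i, j) = 0" if ij: "i < m" "j < m" for i j
  proof -
    have ijn: "i < n" "j < n"
      using ij n by auto
    have "M $$ (i, j) = unit_vec n i \<bullet> (M *\<^sub>v unit_vec n j)"
      using M ijn mult_unit_vec_index[OF M ijn] by (subst scalar_prod_left_unit[of _ n]) (auto simp del: index_mult_mat_vec)
    also have "\<dots> = form S (col P i) (col P j)"
      unfolding M_def using form_mult[OF P(1), of "unit_vec n i" "unit_vec n j"] P_unit ijn by simp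
    finally show ?thesis
      using lagrangian_form_zero[OF L(1)] col ij by simp
  qed
  have PT: "P * T = g * P"
  proof -
    have "P * T = P * Q * (g * P)"
      unfolding T_def using P(1) Q(1) gc by (simp add: assoc_mult_mat[of _ n n _ n _ n])
    also have "\<dots> = g * P"
      unfolding Q(2) using P(1) gc by simp
    finally show ?thesis .
  qed
  have "transpose_mat T * M * T = transpose_mat (P * T) * S * (P * T)"
    unfolding M_def using P T S by (simp add: transpose_mult[of _ n n _ n] assoc_mult_mat[of _ n n _ n _ n])
  also have "\<dots> = transpose_mat P * (transpose_mat g * S * g) * P"
    unfolding PT using P gc S by (simp add: transpose_mult[of _ n n _ n] assoc_mult_mat[of _ n n _ n _ n])
  also have "\<dots> = M"
    using g by (simp add: isometry_def M_def)
  finally have TMT: "transpose_mat T * M * T = M" .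
  have detM: "det M \<noteq> 0"
    unfolding M_def using P S nondegenerate by (simp add: det_mult[of _ n] det_transpose[of _ n])
  obtain A B C D where T_split: "split_block T m m = (A, B, C, D)"
    by (metis prod_cases4)
  obtain E U W X where M_split: "split_block M m m = (E, U, W, X)"
    by (metis prod_cases4)
  note TB = split_block[OF T_split, of m m] and MB = split_block[OF M_split, of m m]
  have dims: "dim_row T = m + m" "dim_col T = m + m" "dim_row M = m + m" "dim_col M = m + m"
    using T M n by auto
  have "C = 0\<^sub>m m m"
    using T_split T0 dims n by (auto simp: split_block_def Let_def intro!: eq_matI)
  moreover have "E = 0\<^sub>m m m"
    using M_split M0 dims n by (auto simp: split_block_def Let_def intro!: eq_matI)
  ultimately have "det T = 1"
    using det_block_isometry[of A m B D U W X T M] TB MB dims TMT detM by simp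
  moreover have "det T = det Q * det g * det P"
    unfolding T_def using P Q gc by (simp add: det_mult[of _ n])
  moreover have "det Q * det P = 1"
    using det_mult[OF Q(1) P(1)] Q by simp
  moreover have "det Q * det g * det P = (det Q * det P) * det g"
    by (simp only: mult_ac)
  ultimately show ?thesis
    by simp
qed

text \<open>Move \<open>L\<close> to \<open>E\<close> by \<open>r\<close> and \<open>g L\<close> to \<open>E\<close> by \<open>s\<close>, with the determinants known from the
  reflections. Then \<open>r\<inverse> s g\<close> stabilises \<open>L\<close> and has determinant \<open>1\<close>. For a skew form this
  says that symplectic matrices have determinant \<open>1\<close>; for a symmetric form it says that the
  isometries of determinant \<open>1\<close> are those that keep the parity of the dimension of the
  intersection of \<open>L\<close> with \<open>E\<close>.\<close>

lemma det_isometry_via_lagrangian: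
  assumes n: "n = 2 * m" and L: "lagrangian n S L" "subspace_dim n L = m" and E: "lagrangian n S E"
    and g: "isometry n S g"
  shows "det g = (- \<epsilon>) ^ (subspace_dim n (L \<inter> E) + subspace_dim n ((*\<^sub>v) g ` L \<inter> E))"
proof -
  have Lc: "L \<subseteq> carrier_vec n"
    using L by (simp add: lagrangian_def subspace_iff)
  obtain r where r: "isometry n S r" "(*\<^sub>v) r ` L = E"
    "det r = (- \<epsilon>) ^ (subspace_dim n (L \<inter> E) + subspace_dim n E)"
    by (rule lagrangians_connected[OF L(1) E])
  obtain s where s: "isometry n S s" "(*\<^sub>v) s ` ((*\<^sub>v) g ` L) = E"
    "det s = (- \<epsilon>) ^ (subspace_dim n ((*\<^sub>v) g ` L \<inter> E) + subspace_dim n E)"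
    by (rule lagrangians_connected[OF lagrangian_image[OF g L(1)] E])
  obtain r' where r': "isometry n S r'" "r * r' = 1\<^sub>m n" "r' * r = 1\<^sub>m n"
    by (rule isometry_inverse[OF r(1)])
  note car = isometry_carrier[OF g] isometry_carrier[OF r(1)] isometry_carrier[OF s(1)] isometry_carrier[OF r'(1)]
  have "r' * (s * g) *\<^sub>v x \<in> L" if x: "x \<in> L" for x
  proof -
    have "s *\<^sub>v (g *\<^sub>v x) \<in> (*\<^sub>v) r ` L"
      unfolding r(2) s(2)[symmetric] using x by blast
    then obtain y where y: "y \<in> L" "s *\<^sub>v (g *\<^sub>v x) = r *\<^sub>v y"
      by blast
    have "r' * (s * g) *\<^sub>v x = r' *\<^sub>v (r *\<^sub>v y)"
      using car x Lc y by (auto simp: assoc_mult_mat_vec[of _ n n _ n])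
    also have "\<dots> = y"
      using mult_inverse_mat_vec[OF car(4,2) r'(3)] y Lc by auto
    finally show ?thesis
      using y by simp
  qed
  then have "det (r' * (s * g)) = 1"
    by (intro det_lagrangian_stabilizer[OF n L] isometry_mult r' s g) blast
  moreover have "det (r * (r' * (s * g))) = det (s * g)"
    using car r'(2) by (simp add: assoc_mult_mat[of _ n n _ n _ n, symmetric] del: assoc_mult_mat)
  ultimately have "det r = det s * det g"
    using car by (simp add: det_mult[of _ n])
  moreover have "det s * det s = 1"
    using isometry_det[OF s(1)] by auto
  ultimately have "det g = det s * det r"
    by (metis mult.assoc mult_1)
  moreover have "(- \<epsilon>) ^ k * (- \<epsilon>) ^ k = 1" for k
    using eps_cases by (auto simp flip: power_mult_distrib)
  ultimately show ?thesis
    unfolding r(3) s(3) power_add by (simp add: mult.assoc mult.left_commute)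
qed

section \<open>Correcting a linear map to an isometry\<close>

lemma self_adjoint_poly_mat:
  assumes A: "A \<in> carrier_mat n n" "S * A = transpose_mat A * S"
  shows "S * poly_mat A p = transpose_mat (poly_mat A p) * S"
proof -
  have "S * poly_mat A p = transpose_mat (poly_mat A p) * S \<and> A * poly_mat A p = poly_mat A p * A"
    using A(1)
  proof (induction rule: poly_mat_induct)
    case zero
    then show ?case
      using A S by simp
  next
    case (step c M)
    have M: "M \<in> carrier_mat n n" "S * M = transpose_mat M * S" "A * M = M * A"
      using step by auto
    have "S * (A * M) = transpose_mat (A * M) * S"
    proof -
      have "S * (A * M) = transpose_mat A * (S * M)"
        using A M(1) S by (simp add: assoc_mult_mat[of _ n n _ n _ n, symmetric] del: assoc_mult_mat)
      also have "\<dots> = transpose_mat (M * A) * S"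
        using A M S by (simp add: transpose_mult[of _ n n _ n] assoc_mult_mat[of _ n n _ n _ n])
      finally show ?thesis
        using M by simp
    qed
    moreover have "A * (A * M) = A * M * A"
      using assoc_mult_mat[OF A(1) M(1) A(1)] M(3) by simp
    ultimately show ?case
      using A M(1) S
      by (simp add: mult_add_distrib_mat[of _ n n _ n] add_mult_distrib_mat[of _ n n _ _ n]
          transpose_add[of _ n n] transpose_smult_mat mult_smult_distrib[of _ n n _ n] mult_smult_assoc_mat[of _ n n _ n])
  qed
  then show ?thesis ..
qed

text \<open>With \<open>M\<^sup>* = S\<inverse> M\<^sup>T S\<close> for the adjoint, \<open>A = k\<^sup>* k\<close> is self-adjoint, hence so is its
  inverse square root \<open>C = p(A)\<close>, and \<open>(k C)\<^sup>* (k C) = C A C = 1\<close>. This is an algebraic form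
  of the polar decomposition of \<open>k\<close>. The polynomial \<open>q\<close> witnesses that the inverse of \<open>C\<close> is
  a polynomial in \<open>A\<close> as well, so that \<open>C\<close> maps each \<open>A\<close>-invariant subspace onto itself.\<close>

lemma isometric_correction:
  assumes k: "k \<in> carrier_mat n n" "det k \<noteq> 0"
  obtains A p q where "A \<in> carrier_mat n n" "S * A = transpose_mat k * S * k"
    "isometry n S (k * poly_mat A p)" "poly_mat A p * poly_mat A q = 1\<^sub>m n"
proof -
  obtain S' where S': "S' \<in> carrier_mat n n" "S * S' = 1\<^sub>m n" "S' * S = 1\<^sub>m n"
    by (rule det_nonzero_inverse[OF S nondegenerate])
  define A where "A = S' * (transpose_mat k * S * k)"
  have A: "A \<in> carrier_mat n n"
    using S' k S by (auto simp: A_def)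
  have SA: "S * A = transpose_mat k * S * k"
  proof -
    define N where "N = transpose_mat k * S * k"
    have "N \<in> carrier_mat n n"
      using k S by (simp add: N_def)
    then show ?thesis
      unfolding A_def N_def[symmetric] using assoc_mult_mat[OF S S'(1), of N n] S'(2) by simp
  qed
  have "transpose_mat A * S = transpose_mat (transpose_mat S * A)"
    using A S by (simp add: transpose_mult[of _ n n _ n])
  also have "\<dots> = \<epsilon> \<cdot>\<^sub>m transpose_mat (S * A)"
    unfolding transpose_S using A S by (simp add: mult_smult_assoc_mat[of _ n n _ n] transpose_smult_mat)
  also have "transpose_mat (S * A) = transpose_mat k * transpose_mat S * k"
    unfolding SA using k S by (simp add: transpose_mult[of _ n n _ n] assoc_mult_mat[of _ n n _ n _ n])
  also have "\<dots> = \<epsilon> \<cdot>\<^sub>m (S * A)"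
    unfolding transpose_S SA using k S
    by (simp add: mult_smult_assoc_mat[of _ n n _ n] mult_smult_distrib[of _ n n _ n])
  also have "\<epsilon> \<cdot>\<^sub>m (\<epsilon> \<cdot>\<^sub>m (S * A)) = S * A"
    using eps_square A S by (intro eq_matI) (auto simp flip: mult.assoc)
  finally have adj: "S * A = transpose_mat A * S" ..
  have "det (S * A) \<noteq> 0"
    unfolding SA using k S nondegenerate by (simp add: det_mult[of _ n] det_transpose[of _ n])
  then have "det A \<noteq> 0"
    using A S by (auto simp: det_mult[of _ n])
  then obtain r where r: "A * poly_mat A r * poly_mat A r = 1\<^sub>m n"
    using matrix_inverse_square_root[OF A] by blast
  define C where "C = poly_mat A r"
  have C: "C \<in> carrier_mat n n"
    unfolding C_def by (rule poly_mat_carrier[OF A])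
  have pA: "poly_mat A [:0, 1:] = A"
    using A by (auto simp: poly_mat_pCons[OF A] poly_mat_0[OF A] intro!: eq_matI)
  have "C * poly_mat A ([:0, 1:] * r) = poly_mat A (r * ([:0, 1:] * r))"
    unfolding C_def poly_mat_mult[OF A] ..
  also have "r * ([:0, 1:] * r) = [:0, 1:] * r * r"
    by (simp only: mult_ac)
  also have "poly_mat A \<dots> = 1\<^sub>m n"
    using r unfolding poly_mat_mult[OF A] pA .
  finally have inv: "C * poly_mat A ([:0, 1:] * r) = 1\<^sub>m n" .
  have "transpose_mat (k * C) * S * (k * C) = transpose_mat C * (S * A) * C"
    unfolding SA using C k S by (simp add: transpose_mult[of _ n n _ n] assoc_mult_mat[of _ n n _ n _ n])
  also have "\<dots> = (transpose_mat C * S) * (A * C)"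
    using A C S by (simp add: assoc_mult_mat[of _ n n _ n _ n])
  also have "transpose_mat C * S = S * C"
    using self_adjoint_poly_mat[OF A adj] by (simp add: C_def)
  also have "S * C * (A * C) = S * (C * poly_mat A ([:0, 1:] * r))"
    unfolding poly_mat_mult[OF A] pA C_def[symmetric] using A C S by (simp add: assoc_mult_mat[of _ n n _ n _ n])
  also have "\<dots> = S"
    unfolding inv using S by simp
  finally have "isometry n S (k * C)"
    using k C by (simp add: isometry_def)
  then show thesis
    using that[OF A SA] inv unfolding C_def by blast
qed

end

section \<open>Groups acting on flags\<close>

lemma mat_mult_left_cancel:
  fixes M X Y :: "'a :: field mat"
  assumes M: "M \<in> carrier_mat n n" "det M \<noteq> 0" and X: "X \<in> carrier_mat n m" and Y: "Y \<in> carrier_mat n m"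
    and eq: "M * X = M * Y"
  shows "X = Y"
proof -
  obtain M' where M': "M' \<in> carrier_mat n n" "M' * M = 1\<^sub>m n"
    using det_nonzero_inverse[OF M] by blast
  have "Z = M' * (M * Z)" if "Z \<in> carrier_mat n m" for Z
    using assoc_mult_mat[OF M'(1) M(1) that] M'(2) left_mult_one_mat[OF that] by metis
  then show ?thesis
    using X Y eq by metis
qed

lemma carrier_GL: "carrier (GL N) = {g \<in> carrier_mat N N. det g \<noteq> 0}"
  unfolding GL_def units_of_carrier
  using det_non_zero_imp_unit[of _ N "()"] unit_imp_det_non_zero[of _ N "()"]
  by (auto simp: Units_def ring_mat_simps)

lemma conj_fixed_iff_commute:
  assumes h: "h \<in> carrier (GL N)" and g: "g \<in> carrier_mat N N"
  shows "h * g * inv\<^bsub>GL N\<^esub> h = g \<longleftrightarrow> h * g = g * h"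
proof -
  interpret ring "ring_mat TYPE(complex) N ()"
    by (rule ring_mat)
  interpret GL: group "GL N"
    unfolding GL_def by (rule units_group)
  define h' where "h' = inv\<^bsub>GL N\<^esub> h"
  have hc: "h \<in> carrier_mat N N" and h'c: "h' \<in> carrier_mat N N"
    using h GL.inv_closed[OF h] by (auto simp: carrier_GL h'_def)
  have inv: "h * h' = 1\<^sub>m N" "h' * h = 1\<^sub>m N"
    using GL.r_inv[OF h] GL.l_inv[OF h] by (simp_all add: GL_def units_of_mult units_of_one ring_mat_simps h'_def)
  have "h * g = g * h" if "h * g * h' = g"
  proof -
    have "g * h = h * g * (h' * h)"
      using assoc_mult_mat[of "h * g" N N h' N h N] hc h'c g that by simp
    then show ?thesis
      using inv hc g by simp
  qed
  moreover have "h * g * h' = g" if "h * g = g * h"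
    unfolding that using assoc_mult_mat[OF g hc h'c] inv g by simp
  ultimately show ?thesis
    unfolding h'_def by blast
qed

lemma flag_act_nth: "i < length F \<Longrightarrow> flag_act g F ! i = (*\<^sub>v) g ` (F ! i)"
  by (simp add: flag_act_def)

lemma flag_subspace:
  assumes "F \<in> flag_variety n" "i \<le> n"
  shows "VectorSpace.subspace class_ring (F ! i) (Vec n)" "subspace_dim n (F ! i) = i" "i < length F"
  using assms by (auto simp: flag_variety_def)

lemma flag_member_carrier:
  assumes "F \<in> flag_variety n" "W \<in> set F"
  shows "W \<subseteq> carrier_vec n"
proof -
  interpret vec_space "TYPE(complex)" n .
  obtain i where "i \<le> n" "W = F ! i"
    using assms by (auto simp: in_set_conv_nth flag_variety_def simp flip: less_Suc_eq_le)
  then show ?thesis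
    using flag_subspace[OF assms(1)] by (auto simp: subspace_iff)
qed

lemma flag_act_mult:
  assumes "g \<in> carrier_mat n n" "g' \<in> carrier_mat n n" "F \<in> flag_variety n"
  shows "flag_act (g * g') F = flag_act g (flag_act g' F)"
  unfolding flag_act_def
  using assms flag_member_carrier[OF assms(3)]
  by (force simp: image_image subset_iff intro!: image_cong)

lemma flag_act_one:
  assumes "F \<in> flag_variety n"
  shows "flag_act (1\<^sub>m n) F = F"
  unfolding flag_act_def
  using flag_member_carrier[OF assms] by (intro map_idI) (force simp: image_def subset_iff)

lemma flag_act_flag_variety:
  assumes g: "g \<in> carrier_mat n n" "det g \<noteq> 0" and F: "F \<in> flag_variety n"
  shows "flag_act g F \<in> flag_variety n"
proof -
  interpret vec_space "TYPE(complex)" n .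
  note sub = flag_subspace[OF F]
  have gF: "VectorSpace.subspace class_ring (flag_act g F ! i) (Vec n)" "subspace_dim n (flag_act g F ! i) = i"
    if "i \<le> n" for i
    using sub[OF that] subspace_image[OF _ g(1)] dim_image[OF _ g]
    by (simp_all add: flag_act_nth subspace_dim_def)
  have "flag_act g F ! i \<subset> flag_act g F ! (i + 1)" if i: "i < n" for i
  proof -
    have "F ! i \<subseteq> F ! (i + 1)"
      using F i by (auto simp: flag_variety_def)
    then have "flag_act g F ! i \<subseteq> flag_act g F ! (i + 1)"
      using sub[of i] sub[of "i + 1"] i by (auto simp: flag_act_nth)
    moreover have "flag_act g F ! i \<noteq> flag_act g F ! (i + 1)"
      using gF(2)[of i] gF(2)[of "i + 1"] i by auto
    ultimately show ?thesis
      by blast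
  qed
  moreover have "flag_act g F ! n = carrier_vec n"
  proof -
    obtain g' where g': "g' \<in> carrier_mat n n" "g * g' = 1\<^sub>m n"
      using det_nonzero_inverse[OF g] by blast
    have "v \<in> (*\<^sub>v) g ` carrier_vec n" if "v \<in> carrier_vec n" for v
      using mult_inverse_mat_vec[OF g(1) g' that] mult_mat_vec_carrier[OF g'(1) that] by (metis imageI)
    then show ?thesis
      using F g by (auto simp: flag_act_nth flag_variety_def)
  qed
  ultimately show ?thesis
    using gF F by (simp add: flag_variety_def) (simp add: flag_act_def)
qed

context eps_symmetric_form
begin

lemma isotropic_flag_act:
  assumes g: "isometry n S g" and F: "F \<in> isotropic_flags n S"
  shows "flag_act g F \<in> isotropic_flags n S"
proof -
  have Fv: "F \<in> flag_variety n" and perp: "\<And>i. i \<le> n \<Longrightarrow> F ! (n - i) = perp n S (F ! i)"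
    using F by (auto simp: isotropic_flags_def)
  have "flag_act g F ! (n - i) = perp n S (flag_act g F ! i)" if "i \<le> n" for i
    using perp[OF that] perp_image[OF g, of "F ! i"] flag_subspace[OF Fv that] flag_subspace(3)[OF Fv, of "n - i"] that
    by (simp add: flag_act_nth subspace_iff)
  moreover have "det g \<noteq> 0"
    using isometry_det[OF g] by auto
  ultimately show ?thesis
    using flag_act_flag_variety[OF isometry_carrier[OF g] _ Fv] by (simp add: isotropic_flags_def)
qed

lemma isotropic_flag_form_zero:
  assumes F: "F \<in> isotropic_flags n S" and i: "i \<le> n" and "v \<in> F ! i" "w \<in> F ! (n - i)"
  shows "form S w v = 0"
  using assms by (auto simp: isotropic_flags_def perp_def)

lemma isotropic_flag_lagrangian:
  assumes F: "F \<in> isotropic_flags n S" and n: "n = 2 * m"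
  shows "lagrangian n S (F ! m)" "subspace_dim n (F ! m) = m"
proof -
  have Fv: "F \<in> flag_variety n"
    using F by (simp add: isotropic_flags_def)
  have "m \<le> n"
    using n by simp
  then have "F ! (n - m) = perp n S (F ! m)"
    using F unfolding isotropic_flags_def by blast
  then show "lagrangian n S (F ! m)" "subspace_dim n (F ! m) = m"
    using flag_subspace[OF Fv, of m] n by (simp_all add: lagrangian_def)
qed

lemma poly_mat_subspace_invariant:
  assumes A: "A \<in> carrier_mat n n" and W: "VectorSpace.subspace class_ring W V"
    and inv: "\<And>v. v \<in> W \<Longrightarrow> A *\<^sub>v v \<in> W" and v: "v \<in> W"
  shows "poly_mat A p *\<^sub>v v \<in> W"
  using A
proof (induction rule: poly_mat_induct)
  case zero
  have "0\<^sub>m n n *\<^sub>v v = 0\<^sub>v n"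
    using v W by (intro eq_vecI) (auto simp: subspace_iff)
  then show ?case
    using W by (simp add: subspace_iff)
next
  case (step c M)
  have vc: "v \<in> carrier_vec n"
    using v W by (auto simp: subspace_iff)
  have "(c \<cdot>\<^sub>m 1\<^sub>m n) *\<^sub>v v = c \<cdot>\<^sub>v v"
    using vc by (intro eq_vecI) auto
  then have "(c \<cdot>\<^sub>m 1\<^sub>m n + A * M) *\<^sub>v v = c \<cdot>\<^sub>v v + A *\<^sub>v (M *\<^sub>v v)"
    using A step(1) vc by (subst add_mult_distrib_mat_vec[of _ n n]) auto
  then show ?case
    using subspace_add[OF W subspace_smult[OF W v] inv[OF step(2)]] by simp
qed

lemma poly_mat_commute:
  assumes A: "A \<in> carrier_mat n n" and h: "h \<in> carrier_mat n n" "A * h = h * A"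
  shows "poly_mat A p * h = h * poly_mat A p"
  using A
proof (induction rule: poly_mat_induct)
  case zero
  then show ?case using h by simp
next
  case (step c M)
  have "A * M * h = A * (h * M)"
    using A step h by simp
  also have "\<dots> = h * (A * M)"
    using assoc_mult_mat[OF A h(1) step(1)] assoc_mult_mat[OF h(1) A step(1)] h(2) by simp
  finally show ?case
    using A step(1) h(1)
    by (simp add: add_mult_distrib_mat[of _ n n _ _ n] mult_add_distrib_mat[of _ n n _ n]
        mult_smult_distrib[of _ n n _ n] mult_smult_assoc_mat[of _ n n _ n] del: assoc_mult_mat)
qed

text \<open>The corrected map \<open>g = k C\<close> has the required properties because \<open>C\<close> is a polynomial in
  \<open>A = k\<^sup>* k\<close>. The matrix \<open>A\<close> commutes with \<open>h\<close>, as \<open>h\<close> is an isometry that commutes with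
  \<open>k\<close>. It leaves each \<open>F\<^sub>i\<close> invariant: for \<open>v\<close> in \<open>F\<^sub>i\<close> and \<open>w\<close> in \<open>F\<^sub>n\<^sub>-\<^sub>i\<close> the number
  \<open>B(w, A v) = B(k w, k v)\<close> vanishes since \<open>k F\<close> is isotropic, and \<open>F\<^sub>i\<close> is the orthogonal
  complement of \<open>F\<^sub>n\<^sub>-\<^sub>i\<close>.\<close>

lemma isometry_between_isotropic_flags:
  assumes k: "k \<in> carrier_mat n n" "det k \<noteq> 0" and h: "isometry n S h" "h * k = k * h"
    and F: "F \<in> isotropic_flags n S" and kF: "flag_act k F \<in> isotropic_flags n S"
  obtains g where "isometry n S g" "h * g = g * h" "flag_act g F = flag_act k F"
proof -
  obtain A p q where A: "A \<in> carrier_mat n n" "S * A = transpose_mat k * S * k"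
    and iso: "isometry n S (k * poly_mat A p)" and inv: "poly_mat A p * poly_mat A q = 1\<^sub>m n"
    by (rule isometric_correction[OF k])
  define C where "C = poly_mat A p"
  define C' where "C' = poly_mat A q"
  have C: "C \<in> carrier_mat n n" "C' \<in> carrier_mat n n"
    using poly_mat_carrier[OF A(1)] by (auto simp: C_def C'_def)
  have hc: "h \<in> carrier_mat n n" and hS: "transpose_mat h * S * h = S"
    using h by (auto simp: isometry_def)
  have form_A: "form S v (A *\<^sub>v w) = form S (k *\<^sub>v v) (k *\<^sub>v w)" if "v \<in> carrier_vec n" "w \<in> carrier_vec n" for v w
  proof -
    have "form S v (A *\<^sub>v w) = v \<bullet> (S * A *\<^sub>v w)"
      using that A(1) S by (simp add: form_def)
    then show ?thesis
      using form_mult[OF k(1) that] A(2) by simp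
  qed
  \<comment> \<open>Multiplied by the invertible matrix \<open>h\<^sup>T S\<close> from the left, both sides become \<open>k\<^sup>T S k\<close>.\<close>
  have "A * h = h * A"
  proof (rule mat_mult_left_cancel[of "transpose_mat h * S"])
    have "transpose_mat h * S * (A * h) = transpose_mat h * (S * A) * h"
      using hc S A(1) by (simp add: assoc_mult_mat[of _ n n _ n _ n])
    also have "\<dots> = transpose_mat (k * h) * S * (k * h)"
      unfolding A(2) using hc S k by (simp add: transpose_mult[of _ n n _ n] assoc_mult_mat[of _ n n _ n _ n])
    also have "\<dots> = transpose_mat (h * k) * S * (h * k)"
      by (simp only: h(2))
    also have "\<dots> = transpose_mat k * (transpose_mat h * S * h) * k"
      using hc S k by (simp add: transpose_mult[of _ n n _ n] assoc_mult_mat[of _ n n _ n _ n])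
    also have "\<dots> = S * A"
      unfolding hS A(2) ..
    also have "\<dots> = transpose_mat h * S * h * A"
      by (simp only: hS)
    also have "\<dots> = transpose_mat h * S * (h * A)"
      using hc S A(1) by (simp add: assoc_mult_mat[of _ n n _ n _ n])
    finally show "transpose_mat h * S * (A * h) = transpose_mat h * S * (h * A)" .
    show "det (transpose_mat h * S) \<noteq> 0"
      using isometry_det[OF h(1)] hc S nondegenerate by (auto simp: det_mult[of _ n] det_transpose[of _ n])
  qed (use hc S A in auto)
  then have "C * h = h * C"
    unfolding C_def by (rule poly_mat_commute[OF A(1) hc])
  then have "h * (k * C) = k * C * h"
    using assoc_mult_mat[OF hc k(1) C(1)] assoc_mult_mat[OF k(1) hc C(1)] assoc_mult_mat[OF k(1) C(1) hc] h(2) by simp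
  moreover have "flag_act (k * C) F = flag_act k F"
  proof -
    have Fv: "F \<in> flag_variety n"
      using F by (simp add: isotropic_flags_def)
    have "(*\<^sub>v) C ` W = W" if W_in: "W \<in> set F" for W
    proof -
      obtain i where i: "i \<le> n" "W = F ! i"
        using W_in Fv by (auto simp: in_set_conv_nth flag_variety_def simp flip: less_Suc_eq_le)
      have W: "VectorSpace.subspace class_ring W V"
        using flag_subspace[OF Fv i(1)] i by simp
      have "F ! (n - (n - i)) = perp n S (F ! (n - i))"
        using F unfolding isotropic_flags_def by auto
      then have Wperp: "W = perp n S (F ! (n - i))"
        using i by simp
      have A_inv: "A *\<^sub>v v \<in> W" if v: "v \<in> W" for v
        unfolding Wperp perp_def
      proof (intro CollectI conjI ballI)
        have vc: "v \<in> carrier_vec n"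
          using v W by (auto simp: subspace_iff)
        then show "A *\<^sub>v v \<in> carrier_vec n"
          using A by simp
        fix w assume w: "w \<in> F ! (n - i)"
        have wc: "w \<in> carrier_vec n"
          using w flag_subspace[OF Fv, of "n - i"] by (auto simp: subspace_iff)
        have "form S w (A *\<^sub>v v) = form S (k *\<^sub>v w) (k *\<^sub>v v)"
          by (rule form_A[OF wc vc])
        also have "\<dots> = 0"
          using isotropic_flag_form_zero[OF kF i(1), of "k *\<^sub>v v" "k *\<^sub>v w"] v w i flag_subspace(3)[OF Fv]
          by (auto simp: flag_act_nth)
        finally show "form S (A *\<^sub>v v) w = 0"
          using form_swap[OF wc, of "A *\<^sub>v v"] vc A by simp
      qed
      have "C *\<^sub>v v \<in> W" "C' *\<^sub>v v \<in> W" if "v \<in> W" for v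
        using poly_mat_subspace_invariant[OF A(1) W A_inv that] by (auto simp: C_def C'_def)
      moreover have "C *\<^sub>v (C' *\<^sub>v v) = v" if "v \<in> W" for v
        using mult_inverse_mat_vec[OF C, of v] inv that W by (auto simp: C_def C'_def subspace_iff)
      ultimately show ?thesis
        by (metis (no_types, lifting) image_eqI image_subsetI subsetI subset_antisym)
    qed
    then have "flag_act C F = F"
      unfolding flag_act_def by (intro map_idI) auto
    then show ?thesis
      using flag_act_mult[OF k(1) C(1) Fv] by simp
  qed
  ultimately show thesis
    using that iso C_def by metis
qed

lemma carrier_isometry_group:
  "carrier (isometry_group n S) = {g. isometry n S g \<and> det g = 1}"
  by (auto simp: isometry_group_def carrier_GL isometry_iff_form)

text \<open>The common reduction for all symmetric pairs. What depends on the pair is the determinant: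
  the isometry that replaces \<open>k\<close> could have determinant \<open>- 1\<close>, to be exchanged then for
  one that acts in the same way on the flag.\<close>

lemma orbit_is_intersection:
  fixes X :: "flag set"
  assumes h: "isometry n S h" and X: "X \<subseteq> isotropic_flags n S"
    and closed: "\<And>g F. isometry n S g \<Longrightarrow> det g = 1 \<Longrightarrow> F \<in> X \<Longrightarrow> flag_act g F \<in> X"
    and det_one: "\<And>g F. isometry n S g \<Longrightarrow> h * g = g * h \<Longrightarrow> F \<in> X \<Longrightarrow> flag_act g F \<in> X \<Longrightarrow>
      \<exists>g'. isometry n S g' \<and> det g' = 1 \<and> h * g' = g' * h \<and> flag_act g' F = flag_act g F"
    and Q: "Q \<in> orbits (fixed_by_conj n h (isometry_group n S)) X flag_act"
  shows "\<exists>Q' \<in> orbits (fixed_by_conj n h (GL n)) (flag_variety n) flag_act. Q = Q' \<inter> X"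
proof -
  have hGL: "h \<in> carrier (GL n)"
    using isometry_carrier[OF h] isometry_det[OF h] by (auto simp: carrier_GL)
  have K': "carrier (fixed_by_conj n h (GL n)) = {g \<in> carrier_mat n n. det g \<noteq> 0 \<and> h * g = g * h}"
    using conj_fixed_iff_commute[OF hGL] by (auto simp: fixed_by_conj_def carrier_GL)
  have K: "carrier (fixed_by_conj n h (isometry_group n S)) = {g. isometry n S g \<and> det g = 1 \<and> h * g = g * h}"
    using conj_fixed_iff_commute[OF hGL] isometry_carrier by (auto simp: fixed_by_conj_def carrier_isometry_group)
  obtain F where F: "F \<in> X" and QF: "Q = orbit (fixed_by_conj n h (isometry_group n S)) flag_act F"
    using Q by (auto simp: orbits_def)
  let ?Q' = "orbit (fixed_by_conj n h (GL n)) flag_act F"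
  have "?Q' \<in> orbits (fixed_by_conj n h (GL n)) (flag_variety n) flag_act"
    using F X by (auto simp: orbits_def isotropic_flags_def)
  moreover have "Q \<subseteq> ?Q' \<inter> X"
    unfolding QF orbit_def K K' using closed F isometry_carrier by fastforce
  moreover have "?Q' \<inter> X \<subseteq> Q"
  proof
    fix F' assume "F' \<in> ?Q' \<inter> X"
    then obtain k where k: "k \<in> carrier_mat n n" "det k \<noteq> 0" "h * k = k * h" "F' = flag_act k F" "F' \<in> X"
      by (auto simp: orbit_def K')
    obtain g where "isometry n S g" "h * g = g * h" "flag_act g F = flag_act k F"
      using isometry_between_isotropic_flags[OF k(1,2) h k(3)] F k(4,5) X by blast
    then obtain g' where "isometry n S g'" "det g' = 1" "h * g' = g' * h" "flag_act g' F = F'"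
      using det_one[of g F] F k by metis
    then show "F' \<in> Q"
      unfolding QF orbit_def K by blast
  qed
  ultimately show ?thesis
    by blast
qed

end

section \<open>Antidiagonal forms and diagonal involutions\<close>

text \<open>The entry function \<open>s\<close> lets the symmetric and the skew antidiagonal form be treated
  together.\<close>

definition antidiag_mat :: "nat \<Rightarrow> (nat \<Rightarrow> complex) \<Rightarrow> complex mat" where
  "antidiag_mat N s = mat N N (\<lambda>(i, j). if i + j + 1 = N then s i else 0)"

lemma antidiag_mat_carrier: "antidiag_mat N s \<in> carrier_mat N N"
  by (simp add: antidiag_mat_def)

lemma antidiag_mat_mult_vec:
  assumes v: "v \<in> carrier_vec N" and i: "i < N"
  shows "(antidiag_mat N s *\<^sub>v v) $ i = s i * v $ (N - 1 - i)"
proof -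
  have "(antidiag_mat N s *\<^sub>v v) $ i = (\<Sum>j = 0..<N. (if i + j + 1 = N then s i else 0) * v $ j)"
    using v i by (simp add: antidiag_mat_def scalar_prod_def)
  also have "\<dots> = (\<Sum>j = 0..<N. if j = N - 1 - i then s i * v $ j else 0)"
    using i by (intro sum.cong) auto
  finally show ?thesis
    using i by simp
qed

lemma det_antidiag_mat:
  assumes "\<And>i. i < N \<Longrightarrow> s i \<noteq> 0"
  shows "det (antidiag_mat N s) \<noteq> 0"
proof
  assume "det (antidiag_mat N s) = 0"
  then obtain v where v: "v \<in> carrier_vec N" "v \<noteq> 0\<^sub>v N" "antidiag_mat N s *\<^sub>v v = 0\<^sub>v N"
    using det_0_iff_vec_prod_zero_field[OF antidiag_mat_carrier] by blast
  have "v $ i = 0" if "i < N" for i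
  proof -
    have "s (N - 1 - i) * v $ i = 0"
      using antidiag_mat_mult_vec[OF v(1), of "N - 1 - i" s] that by (simp add: v(3))
    then show ?thesis
      using assms[of "N - 1 - i"] that by simp
  qed
  then show False
    using v by auto
qed

lemma eps_symmetric_antidiag_mat:
  assumes eps: "\<epsilon> * \<epsilon> = 1" and sym: "\<And>i. i < N \<Longrightarrow> s (N - 1 - i) = \<epsilon> * s i"
    and nz: "\<And>i. i < N \<Longrightarrow> s i \<noteq> 0"
  shows "eps_symmetric_form N (antidiag_mat N s) \<epsilon>"
proof
  show "transpose_mat (antidiag_mat N s) = \<epsilon> \<cdot>\<^sub>m antidiag_mat N s"
  proof (rule eq_matI)
    fix i j assume "i < dim_row (\<epsilon> \<cdot>\<^sub>m antidiag_mat N s)" "j < dim_col (\<epsilon> \<cdot>\<^sub>m antidiag_mat N s)"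
    then have ij: "i < N" "j < N"
      by (simp_all add: antidiag_mat_def)
    have "s j = \<epsilon> * s i" if "i + j + 1 = N"
    proof -
      have "j = N - 1 - i"
        using that by simp
      then show ?thesis
        using sym[OF ij(1)] by simp
    qed
    then show "transpose_mat (antidiag_mat N s) $$ (i, j) = (\<epsilon> \<cdot>\<^sub>m antidiag_mat N s) $$ (i, j)"
      using ij by (simp add: antidiag_mat_def add.commute)
  qed (simp_all add: antidiag_mat_def)
qed (use antidiag_mat_carrier det_antidiag_mat nz eps in auto)

lemma antidiag_eq: "antidiag N = antidiag_mat N (\<lambda>_. 1)"
  by (simp add: antidiag_def antidiag_mat_def)

lemma skew_antidiag_eq: "skew_antidiag n = antidiag_mat (2 * n) (\<lambda>i. if i < n then 1 else - 1)"
  by (intro eq_matI) (auto simp: skew_antidiag_def antidiag_def antidiag_mat_def)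

lemma (in eps_symmetric_form) isometry_mat_diag:
  assumes "\<And>i j. i < n \<Longrightarrow> j < n \<Longrightarrow> S $$ (i, j) \<noteq> 0 \<Longrightarrow> d i * d j = 1"
  shows "isometry n S (mat_diag n d)"
proof -
  have "transpose_mat (mat_diag n d) = mat_diag n d"
    by (intro eq_matI) (auto simp: mat_diag_def)
  moreover have "mat_diag n d * S * mat_diag n d = mat n n (\<lambda>(i, j). d i * S $$ (i, j) * d j)"
    using S by (subst mat_diag_mult_right[of _ n n]) (auto simp: mat_diag_mult_left[of _ n n] intro!: eq_matI)
  moreover have "mat n n (\<lambda>(i, j). d i * S $$ (i, j) * d j) = S"
  proof (rule eq_matI)
    fix i j assume "i < dim_row S" "j < dim_col S"
    then show "mat n n (\<lambda>(i, j). d i * S $$ (i, j) * d j) $$ (i, j) = S $$ (i, j)"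
      using S assms[of i j] by (cases "S $$ (i, j) = 0") (auto simp: mult.commute mult.left_commute)
  qed (use S in auto)
  ultimately show ?thesis
    by (simp add: isometry_def)
qed

lemma isometry_antidiag_mat_diag:
  assumes "eps_symmetric_form N (antidiag_mat N s) \<epsilon>"
    and "\<And>i. i < N \<Longrightarrow> d i * d (N - 1 - i) = 1"
  shows "isometry N (antidiag_mat N s) (mat_diag N d)"
proof (rule eps_symmetric_form.isometry_mat_diag[OF assms(1)])
  fix i j assume "i < N" "j < N" "antidiag_mat N s $$ (i, j) \<noteq> 0"
  then have "j = N - 1 - i"
    by (auto simp: antidiag_mat_def split: if_splits)
  then show "d i * d j = 1"
    using assms(2) \<open>i < N\<close> by simp
qed

lemma isometry_I3:
  assumes "eps_symmetric_form N (antidiag_mat N s) \<epsilon>" "N = 2 * p + q"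
  shows "isometry N (antidiag_mat N s) (I3 p q p)"
proof -
  have "p + q + p = N"
    using assms(2) by simp
  then show ?thesis
    unfolding I3_def \<open>p + q + p = N\<close>
    using assms(2) by (intro isometry_antidiag_mat_diag[OF assms(1)]) auto
qed

lemma isometry_i_I2:
  assumes "eps_symmetric_form N (antidiag_mat N s) \<epsilon>" "N = 2 * n"
  shows "isometry N (antidiag_mat N s) (\<i> \<cdot>\<^sub>m I2 n n)"
proof -
  \<comment> \<open>Opposite diagonal entries are \<open>\<i>\<close> and \<open>- \<i>\<close>, with product \<open>1\<close>.\<close>
  have "\<i> \<cdot>\<^sub>m I2 n n = mat_diag N (\<lambda>i. if i < n then \<i> else - \<i>)"
    using assms(2) by (intro eq_matI) (auto simp: I2_def mat_diag_def)
  moreover have "isometry N (antidiag_mat N s) (mat_diag N (\<lambda>i. if i < n then \<i> else - \<i>))"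
    by (rule isometry_antidiag_mat_diag[OF assms(1)]) (use assms(2) in auto)
  ultimately show ?thesis
    by simp
qed

text \<open>Membership in terms of vanishing coordinates, which is what computing orthogonal
  complements requires.\<close>

lemma coord_span_eq:
  assumes "k \<le> N"
  shows "coord_span N k = {v \<in> carrier_vec N. \<forall>i. k \<le> i \<longrightarrow> i < N \<longrightarrow> v $ i = 0}"
    and "VectorSpace.subspace class_ring (coord_span N k) (Vec N)"
proof -
  interpret vec_space "TYPE(complex)" N .
  let ?E = "\<lambda>k. {v \<in> carrier_vec N :: complex vec set. \<forall>i. k \<le> i \<longrightarrow> i < N \<longrightarrow> v $ i = 0}"
  have e: "unit_vec N ` {..<k} \<subseteq> carrier_vec N"
    by auto
  then show sub: "VectorSpace.subspace class_ring (coord_span N k) (Vec N)"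
    unfolding coord_span_def using span_is_submodule vec_vs by (auto simp: VectorSpace.subspace_def)
  have "VectorSpace.subspace class_ring (?E k) V"
    by (auto simp: subspace_iff)
  then have "coord_span N k \<subseteq> ?E k"
    unfolding coord_span_def by (intro span_is_subset) (auto simp: VectorSpace.subspace_def)
  moreover have "?E j \<subseteq> coord_span N k" if "j \<le> k" for j
    using that
  proof (induction j)
    case 0
    then have "?E 0 \<subseteq> {0\<^sub>v N}"
      by auto
    then show ?case
      using sub by (auto simp: subspace_iff)
  next
    case (Suc j)
    show ?case
    proof
      fix v :: "complex vec" assume v: "v \<in> ?E (Suc j)"
      have j: "j < N" "j < k"
        using Suc.prems assms by auto
      \<comment> \<open>Subtracting the last coordinate that may be nonzero reduces the support.\<close>
      define w where "w = v + (- v $ j) \<cdot>\<^sub>v unit_vec N j"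
      have vc: "v \<in> carrier_vec N"
        using v by blast
      have w0: "w $ i = 0" if "j \<le> i" "i < N" for i
      proof (cases "i = j")
        case True
        then show ?thesis
          using vc that by (simp add: w_def)
      next
        case False
        then have "v $ i = 0"
          using v that by simp
        then show ?thesis
          using vc that False by (simp add: w_def)
      qed
      have "w \<in> carrier_vec N"
        using vc by (simp add: w_def)
      then have "w \<in> ?E j"
        using w0 by blast
      moreover have "?E j \<subseteq> coord_span N k"
        using j by (intro Suc.IH) simp
      ultimately have w: "w \<in> coord_span N k"
        by (rule rev_subsetD)
      have "unit_vec N j \<in> coord_span N k"
        unfolding coord_span_def using in_own_span[of "unit_vec N ` {..<k}"] e j by auto
      then have "w + v $ j \<cdot>\<^sub>v unit_vec N j \<in> coord_span N k"
        by (intro subspace_add[OF sub w] subspace_smult[OF sub])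
      also have "w + v $ j \<cdot>\<^sub>v unit_vec N j = v"
        using vc by (intro eq_vecI) (auto simp: w_def)
      finally show "v \<in> coord_span N k" .
    qed
  qed
  ultimately show "coord_span N k = ?E k"
    by blast
qed

lemma lagrangian_coord_span:
  assumes N: "N = 2 * n" and s: "\<And>i. i < N \<Longrightarrow> s i \<noteq> 0"
  shows "lagrangian N (antidiag_mat N s) (coord_span N n)"
  unfolding lagrangian_def
proof
  let ?S = "antidiag_mat N s"
  have nN: "n \<le> N"
    using N by simp
  show "VectorSpace.subspace class_ring (coord_span N n) (Vec N)"
    by (rule coord_span_eq(2)[OF nN])
  have form: "form ?S v w = (\<Sum>i = 0..<N. v $ i * (s i * w $ (N - 1 - i)))" if "w \<in> carrier_vec N" for v w
    using antidiag_mat_mult_vec[OF that] antidiag_mat_carrier[of N s]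
    by (auto simp: form_def scalar_prod_def simp del: index_mult_mat_vec intro!: sum.cong)
  show "perp N ?S (coord_span N n) = coord_span N n"
  proof (intro subset_antisym subsetI)
    fix v assume v: "v \<in> perp N ?S (coord_span N n)"
    have "v $ i = 0" if i: "n \<le> i" "i < N" for i
    proof -
      let ?e = "unit_vec N (N - 1 - i) :: complex vec"
      have "?e \<in> coord_span N n"
        using i N unfolding coord_span_eq(1)[OF nN] by auto
      then have "0 = form ?S v ?e"
        using v by (auto simp: perp_def)
      also have "\<dots> = (\<Sum>j = 0..<N. if j = i then v $ j * s j else 0)"
      proof -
        have "(N - 1 - j = N - 1 - i) = (j = i)" if "j < N" for j
          using i that by auto
        then show ?thesis
          using i by (subst form, simp) (intro sum.cong, auto)
      qed
      also have "\<dots> = v $ i * s i"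
        using i by simp
      finally show ?thesis
        using s[OF i(2)] by simp
    qed
    then show "v \<in> coord_span N n"
      using v unfolding coord_span_eq(1)[OF nN] by (auto simp: perp_def)
  next
    fix v assume v: "v \<in> coord_span N n"
    have "form ?S v w = 0" if w: "w \<in> coord_span N n" for w
    proof -
      have vw: "\<And>i. n \<le> i \<Longrightarrow> i < N \<Longrightarrow> v $ i = 0 \<and> w $ i = 0" "w \<in> carrier_vec N"
        using v w unfolding coord_span_eq(1)[OF nN] by auto
      have "v $ i = 0 \<or> w $ (N - 1 - i) = 0" if "i < N" for i
        using vw(1)[of i] vw(1)[of "N - 1 - i"] N that by (cases "n \<le> i") auto
      then show ?thesis
        unfolding form[OF vw(2)] by (intro sum.neutral) fastforce
    qed
    then show "v \<in> perp N ?S (coord_span N n)"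
      using v unfolding coord_span_eq(1)[OF nN] perp_def by auto
  qed
qed

section \<open>Orbits for the families of symmetric pairs\<close>

context eps_symmetric_form
begin

lemma flag_act_smult:
  assumes g: "g \<in> carrier_mat n n" and F: "F \<in> flag_variety n" and c: "c \<noteq> 0"
  shows "flag_act (c \<cdot>\<^sub>m g) F = flag_act g F"
proof -
  have "(*\<^sub>v) (c \<cdot>\<^sub>m g) ` W = (*\<^sub>v) g ` W" if "W \<in> set F" for W
  proof -
    have W: "VectorSpace.subspace class_ring W V"
      using that F by (auto simp: in_set_conv_nth flag_variety_def)
    have Wc: "v \<in> W \<Longrightarrow> v \<in> carrier_vec n" for v
      using W by (auto simp: subspace_iff)
    have scale: "(c \<cdot>\<^sub>m g) *\<^sub>v v = g *\<^sub>v (c \<cdot>\<^sub>v v)" if "v \<in> W" for v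
      using g Wc[OF that] by (intro eq_vecI) auto
    show ?thesis
    proof (intro subset_antisym subsetI)
      fix x assume "x \<in> (*\<^sub>v) (c \<cdot>\<^sub>m g) ` W"
      then show "x \<in> (*\<^sub>v) g ` W"
        using scale subspace_smult[OF W] by auto
    next
      fix x assume "x \<in> (*\<^sub>v) g ` W"
      then obtain v where v: "v \<in> W" "x = g *\<^sub>v v"
        by blast
      have v': "(1 / c) \<cdot>\<^sub>v v \<in> W"
        by (rule subspace_smult[OF W v(1)])
      have "c \<cdot>\<^sub>v ((1 / c) \<cdot>\<^sub>v v) = v"
        using c by (intro eq_vecI) auto
      then have "x = (c \<cdot>\<^sub>m g) *\<^sub>v ((1 / c) \<cdot>\<^sub>v v)"
        using scale[OF v'] v(2) by simp
      then show "x \<in> (*\<^sub>v) (c \<cdot>\<^sub>m g) ` W"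
        using v' by blast
    qed
  qed
  then show ?thesis
    unfolding flag_act_def by simp
qed

lemma isometry_neg:
  assumes "isometry n S g"
  shows "isometry n S ((- 1) \<cdot>\<^sub>m g)"
proof -
  have "((- 1) \<cdot>\<^sub>m g) *\<^sub>v v = (- 1) \<cdot>\<^sub>v (g *\<^sub>v v)" if "v \<in> carrier_vec n" for v
    using isometry_carrier[OF assms] that by (intro eq_vecI) auto
  then show ?thesis
    using assms by (auto simp: isometry_iff_form form_linear)
qed

lemma orbit_is_intersection_of_det_one:
  fixes X :: "flag set"
  assumes h: "isometry n S h" and X: "X \<subseteq> isotropic_flags n S"
    and closed: "\<And>g F. isometry n S g \<Longrightarrow> det g = 1 \<Longrightarrow> F \<in> X \<Longrightarrow> flag_act g F \<in> X"
    and det_one: "\<And>g F. isometry n S g \<Longrightarrow> F \<in> X \<Longrightarrow> flag_act g F \<in> X \<Longrightarrow> det g = 1"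
    and Q: "Q \<in> orbits (fixed_by_conj n h (isometry_group n S)) X flag_act"
  shows "\<exists>Q' \<in> orbits (fixed_by_conj n h (GL n)) (flag_variety n) flag_act. Q = Q' \<inter> X"
  by (rule orbit_is_intersection[OF h X closed _ Q]) (use det_one in blast)+

lemma orbit_is_intersection_skew:
  assumes "\<epsilon> = - 1" and n: "n = 2 * m" and h: "isometry n S h"
    and Q: "Q \<in> orbits (fixed_by_conj n h (isometry_group n S)) (isotropic_flags n S) flag_act"
  shows "\<exists>Q' \<in> orbits (fixed_by_conj n h (GL n)) (flag_variety n) flag_act. Q = Q' \<inter> isotropic_flags n S"
proof (rule orbit_is_intersection_of_det_one[OF h subset_refl _ _ Q])
  fix g F assume g: "isometry n S g" and F: "F \<in> isotropic_flags n S"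
  show "flag_act g F \<in> isotropic_flags n S"
    by (rule isotropic_flag_act[OF g F])
  note L = isotropic_flag_lagrangian[OF F n]
  show "det g = 1"
    using det_isometry_via_lagrangian[OF n L L(1) g] assms(1) by simp
qed

text \<open>In odd dimension \<open>- g\<close> acts on flags like \<open>g\<close> and has the opposite determinant.\<close>

lemma orbit_is_intersection_odd:
  assumes n: "odd n" and h: "isometry n S h"
    and Q: "Q \<in> orbits (fixed_by_conj n h (isometry_group n S)) (isotropic_flags n S) flag_act"
  shows "\<exists>Q' \<in> orbits (fixed_by_conj n h (GL n)) (flag_variety n) flag_act. Q = Q' \<inter> isotropic_flags n S"
proof (rule orbit_is_intersection[OF h subset_refl _ _ Q])
  fix g F assume g: "isometry n S g" and F: "F \<in> isotropic_flags n S"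
  show "flag_act g F \<in> isotropic_flags n S"
    by (rule isotropic_flag_act[OF g F])
  assume comm: "h * g = g * h"
  note gc = isometry_carrier[OF g] and hc = isometry_carrier[OF h]
  show "\<exists>g'. isometry n S g' \<and> det g' = 1 \<and> h * g' = g' * h \<and> flag_act g' F = flag_act g F"
  proof (cases "det g = 1")
    case True
    then show ?thesis
      using g comm by blast
  next
    case False
    let ?g = "(- 1) \<cdot>\<^sub>m g"
    have "det ?g = 1"
      using False isometry_det[OF g] gc n by simp
    moreover have "h * ?g = ?g * h"
      using comm gc hc by (simp add: mult_smult_distrib[of _ n n _ n] mult_smult_assoc_mat[of _ n n _ n])
    moreover have "flag_act ?g F = flag_act g F"
      using F gc by (intro flag_act_smult) (auto simp: isotropic_flags_def)
    ultimately show ?thesis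
      using isometry_neg[OF g] by blast
  qed
qed

text \<open>The space spanned by the first \<open>m\<close> unit vectors is Lagrangian, so the determinant of an
  isometry records how the parity that defines the component changes.\<close>

lemma orbit_is_intersection_even_component:
  assumes "\<epsilon> = 1" and n: "n = 2 * m" and E: "lagrangian n S (coord_span n m)" and h: "isometry n S h"
    and Q: "Q \<in> orbits (fixed_by_conj n h (isometry_group n S)) (even_component m S) flag_act"
  shows "\<exists>Q' \<in> orbits (fixed_by_conj n h (GL n)) (flag_variety n) flag_act. Q = Q' \<inter> even_component m S"
proof (rule orbit_is_intersection_of_det_one[OF h _ _ _ Q])
  show "even_component m S \<subseteq> isotropic_flags n S"
    by (auto simp: even_component_def n)
  fix g F assume g: "isometry n S g" and F: "F \<in> even_component m S"
  define d where "d F = subspace_dim n (F ! m \<inter> coord_span n m)" for F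
  have component: "F \<in> even_component m S \<longleftrightarrow> F \<in> isotropic_flags n S \<and> d F mod 2 = m mod 2" for F
    by (simp add: even_component_def n d_def)
  have iso: "F \<in> isotropic_flags n S"
    using F component by blast
  have len: "m < length F"
    using iso n by (simp add: isotropic_flags_def flag_variety_def)
  have det: "det g = (- 1) ^ (d F + d (flag_act g F))"
    using det_isometry_via_lagrangian[OF n isotropic_flag_lagrangian[OF iso n] E g] assms(1) len
    by (simp add: d_def flag_act_nth)
  have parity: "det g = 1 \<longleftrightarrow> d (flag_act g F) mod 2 = d F mod 2"
    unfolding det by (cases "even (d F + d (flag_act g F))") (auto simp: mod2_eq_if)
  show "flag_act g F \<in> even_component m S" if "det g = 1"
    using that parity F isotropic_flag_act[OF g iso] by (simp add: component)
  show "det g = 1" if "flag_act g F \<in> even_component m S"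
    using that parity F by (simp add: component)
qed

text \<open>If \<open>g\<close> connects two flags of one orbit of the special orthogonal group, then up to
  isometries of determinant \<open>1\<close> it stabilises a flag, whose middle member is Lagrangian. So
  \<open>det g = 1\<close>.\<close>

lemma orbit_is_intersection_SO_orbit:
  assumes n: "n = 2 * m" and X: "X \<in> orbits (isometry_group n S) (isotropic_flags n S) flag_act"
    and h: "isometry n S h"
    and Q: "Q \<in> orbits (fixed_by_conj n h (isometry_group n S)) X flag_act"
  shows "\<exists>Q' \<in> orbits (fixed_by_conj n h (GL n)) (flag_variety n) flag_act. Q = Q' \<inter> X"
proof -
  obtain F0 where F0: "F0 \<in> isotropic_flags n S" and X_eq: "X = {flag_act g F0 | g. isometry n S g \<and> det g = 1}"
    using X by (auto simp: orbits_def orbit_def carrier_isometry_group)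
  have F0v: "F0 \<in> flag_variety n"
    using F0 by (simp add: isotropic_flags_def)
  show ?thesis
  proof (rule orbit_is_intersection_of_det_one[OF h _ _ _ Q])
    show "X \<subseteq> isotropic_flags n S"
      using isotropic_flag_act F0 by (auto simp: X_eq)
    fix g F assume g: "isometry n S g" and "F \<in> X"
    then obtain a where a: "isometry n S a" "det a = 1" "F = flag_act a F0"
      by (auto simp: X_eq)
    note gc = isometry_carrier[OF g] and ac = isometry_carrier[OF a(1)]
    have ga: "flag_act g F = flag_act (g * a) F0"
      using flag_act_mult[OF gc ac F0v] a by simp
    show "flag_act g F \<in> X" if "det g = 1"
      using that a g ga isometry_mult[OF g a(1)] det_mult[OF gc ac] by (auto simp: X_eq)
    show "det g = 1" if gF: "flag_act g F \<in> X"
    proof -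
      obtain b where b: "isometry n S b" "det b = 1" "flag_act g F = flag_act b F0"
        using gF by (auto simp: X_eq)
      obtain b' where b': "isometry n S b'" "b * b' = 1\<^sub>m n" "b' * b = 1\<^sub>m n"
        by (rule isometry_inverse[OF b(1)])
      note bc = isometry_carrier[OF b(1)] and b'c = isometry_carrier[OF b'(1)]
      have "flag_act (b' * (g * a)) F0 = flag_act b' (flag_act b F0)"
        using flag_act_mult[OF b'c _ F0v, of "g * a"] gc ac ga b(3) by simp
      also have "\<dots> = F0"
        using flag_act_mult[OF b'c bc F0v] b'(3) flag_act_one[OF F0v] by simp
      finally have stab: "flag_act (b' * (g * a)) F0 = F0" .
      have "m < length F0"
        using F0v n by (simp add: flag_variety_def)
      then have "(*\<^sub>v) (b' * (g * a)) ` (F0 ! m) \<subseteq> F0 ! m"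
        using arg_cong[OF stab, of "\<lambda>F. F ! m"] by (simp add: flag_act_nth)
      then have "det (b' * (g * a)) = 1"
        by (intro det_lagrangian_stabilizer[OF n isotropic_flag_lagrangian[OF F0 n]] isometry_mult b'(1) g a(1))
      moreover have "det b' = 1"
        using det_mult[OF bc b'c] b' b by simp
      ultimately show ?thesis
        using det_mult[OF gc ac] det_mult[OF b'c, of "g * a"] gc ac a(2) by simp
    qed
  qed
qed

end

theorem theorem1p5p8:
  fixes N :: nat and S h :: "complex mat" and X :: "flag set"
    and G G' K K' :: "complex mat monoid" and X' :: "flag set"
  assumes "symmetric_pair N S h X"
  defines "G \<equiv> isometry_group N S"
    and "G' \<equiv> GL N"
    and "K \<equiv> fixed_by_conj N h G"
    and "K' \<equiv> fixed_by_conj N h G'"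
    and "X' \<equiv> flag_variety N"
  shows "\<forall>Q \<in> orbits K X flag_act. \<exists>Q' \<in> orbits K' X' flag_act. Q = Q' \<inter> X"
  unfolding K_def K'_def G_def G'_def X'_def
proof
  fix Q assume Q: "Q \<in> orbits (fixed_by_conj N h (isometry_group N S)) X flag_act"
  have antidiag: "eps_symmetric_form M (antidiag_mat M (\<lambda>_. 1)) 1" for M
    by (rule eps_symmetric_antidiag_mat) auto
  have skew: "eps_symmetric_form (2 * m) (antidiag_mat (2 * m) (\<lambda>i. if i < m then 1 else - 1)) (- 1)" for m
    by (rule eps_symmetric_antidiag_mat) auto
  from assms(1) Q show "\<exists>Q' \<in> orbits (fixed_by_conj N h (GL N)) (flag_variety N) flag_act. Q = Q' \<inter> X"
  proof (cases rule: symmetric_pair.cases)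
    case (SO_odd p q n)
    then have n: "n = p + q"
      by simp
    show ?thesis
      using Q unfolding SO_odd antidiag_eq
      by (intro eps_symmetric_form.orbit_is_intersection_odd[OF antidiag] isometry_I3[OF antidiag]) (use n in auto)
  next
    case (Sp_Sp p q n)
    then have n: "n = p + q"
      by simp
    show ?thesis
      using Q unfolding Sp_Sp skew_antidiag_eq
      by (intro eps_symmetric_form.orbit_is_intersection_skew[OF skew _ refl] isometry_I3[OF skew]) (use n in auto)
  next
    case (Sp_GL n)
    show ?thesis
      using Q unfolding Sp_GL skew_antidiag_eq
      by (intro eps_symmetric_form.orbit_is_intersection_skew[OF skew _ refl] isometry_i_I2[OF skew]) auto
  next
    case (SO_even p q n)
    then have n: "n = p + q"
      by simp
    show ?thesis
      using Q unfolding SO_even antidiag_eq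
      by (intro eps_symmetric_form.orbit_is_intersection_even_component[OF antidiag _ refl]
          lagrangian_coord_span isometry_I3[OF antidiag]) (use n in auto)
  next
    case (SO_GL n)
    show ?thesis
      using Q unfolding SO_GL antidiag_eq
      by (intro eps_symmetric_form.orbit_is_intersection_even_component[OF antidiag _ refl]
          lagrangian_coord_span isometry_i_I2[OF antidiag]) auto
  next
    case (SO_even_odd p q n)
    have form: "eps_symmetric_form N (1\<^sub>m N) 1"
      by unfold_locales (auto intro!: eq_matI)
    have size: "2 * p + 1 + (2 * q - 1) = N"
      using SO_even_odd by simp
    have "isometry N (1\<^sub>m N) (I2 (2 * p + 1) (2 * q - 1))"
      unfolding I2_def size
      by (rule eps_symmetric_form.isometry_mat_diag[OF form]) (auto split: if_splits)
    then show ?thesis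
      using Q SO_even_odd eps_symmetric_form.orbit_is_intersection_SO_orbit[OF form, of n X] by simp
  qed
qed

end
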